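(* Let $E, F$ be Banach lattices such that $E^{*}$ and $F$ have order continuous norms. If $T \colon E \longrightarrow F$ is positive and almost Dunford-Pettis, then $T^{*} \colon F^* \longrightarrow E^*$ is positively limited, that is, $T^*$ is almost limited, hence $T^{**} \colon E^{**} \longrightarrow F^{**}$ is almost Dunford-Pettis.
   Context: Operators are linear. An operator from a Banach lattice to a Banach space is almost Dunford-Pettis if it sends disjoint weakly null sequences to norm null sequences (equivalently, positive disjoint weakly null sequences to norm null sequences). Let $S$ be an operator from a Banach space $X$ to a Banach lattice $G$. $S$ is positively limited if $S^*$ takes positive weak$^*$-null sequences in $G^*$ to norm null sequences in $X^*$. $S$ is almost limited if $S^*$ sends disjoint weak$^*$-null sequences in $G^*$ to norm null sequences in $X^*$. (For $S=T^*$, this concerns sequences in $E^{**}$ that are null for the weak$^*$ topology $\sigma(E^{**},E^* )$.) *)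

theory Defs
  imports "HOL-Analysis.Analysis" "HOL-Library.Lattice_Algebras"
begin

section \<open>Banach lattices\<close>

class banach_lattice = banach + ordered_real_vector + lattice_ab_group_add_abs +
  assumes norm_mono_abs: "\<bar>x\<bar> \<le> \<bar>y\<bar> \<Longrightarrow> norm x \<le> norm y"

instance real :: banach_lattice
  by standard (auto simp: sup_real_def max_def)

lemma norm_mono_pos:
  fixes x y :: "'a::banach_lattice"
  assumes "0 \<le> x" "x \<le> y"
  shows "norm x \<le> norm y"
  using assms by (intro norm_mono_abs) (metis abs_of_nonneg order_trans)

lemma norm_abs_eq [simp]:
  fixes x :: "'a::banach_lattice"
  shows "norm \<bar>x\<bar> = norm x"
  by (intro antisym norm_mono_abs) simp_all

lemma norm_pprt_le:
  fixes x :: "'a::banach_lattice"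
  shows "norm (pprt x) \<le> norm x"
proof -
  have "pprt x \<le> \<bar>x\<bar>"
    by (simp add: pprt_def abs_ge_self)
  then show ?thesis
    using norm_mono_pos[of "pprt x" "\<bar>x\<bar>"] by simp
qed

lemma norm_nprt_le:
  fixes x :: "'a::banach_lattice"
  shows "norm (nprt x) \<le> norm x"
  using norm_pprt_le[of "- x"] by (simp add: pprt_neg)


section \<open>The dual of a Banach lattice\<close>

text \<open>
  The norm dual of \<open>'a\<close> is \<open>'a \<Rightarrow>\<^sub>L real\<close>. An instance for a type constructor cannot
  mention the type \<open>real\<close> itself, so the codomain ranges over the sort
  \<open>{ordered_euclidean_space, linorder}\<close>; \<open>real\<close> is, up to isomorphism, its only member.
  The order is the usual one, and the lattice operations are given by the
  Riesz-Kantorovich formula \<open>h\<^sup>+ x = (SUP y\<in>{0..x}. h y)\<close> for \<open>x \<ge> 0\<close>.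
\<close>

lemma linorder_euclidean_unit:
  obtains u :: "'b::{ordered_euclidean_space, linorder}"
  where "\<And>z c. norm z \<le> c \<longleftrightarrow> - (c *\<^sub>R u) \<le> z \<and> z \<le> c *\<^sub>R u"
proof -
  obtain u :: 'b where u: "u \<in> Basis"
    using nonempty_Basis by blast
  have "v = u" if v: "v \<in> Basis" for v
  proof (rule ccontr)
    assume "v \<noteq> u"
    then have "u \<bullet> u = 1" "v \<bullet> v = 1" "u \<bullet> v = 0" "v \<bullet> u = 0"
      using u v by (simp_all add: inner_Basis)
    moreover have "u \<le> v \<or> v \<le> u"
      by (rule linear)
    ultimately show False
      using inner_Basis_mono[of u v u] inner_Basis_mono[of v u v] u v by auto
  qed
  then have B: "Basis = {u}"
    using u by blast
  have [simp]: "u \<bullet> u = 1"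
    using u by simp
  have n: "norm z = \<bar>z \<bullet> u\<bar>" for z :: 'b
  proof -
    have "(z \<bullet> u) *\<^sub>R u = z"
      using euclidean_representation[of z] unfolding B by simp
    then have "norm z = \<bar>z \<bullet> u\<bar> * norm u"
      using norm_scaleR[of "z \<bullet> u" u] by (simp only:)
    then show ?thesis
      using u by simp
  qed
  have "norm z \<le> c \<longleftrightarrow> - (c *\<^sub>R u) \<le> z \<and> z \<le> c *\<^sub>R u" for z :: 'b and c
    unfolding n eucl_le[of z] eucl_le[of _ z] B by auto
  then show ?thesis
    by (rule that)
qed

definition rk_sup ::
  "('a::banach_lattice \<Rightarrow>\<^sub>L 'b::{ordered_euclidean_space, linorder}) \<Rightarrow> 'a \<Rightarrow> 'b"
  where "rk_sup h x = (SUP y\<in>{0..x}. blinfun_apply h y)"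

definition rk_pos_part ::
  "('a::banach_lattice \<Rightarrow>\<^sub>L 'b::{ordered_euclidean_space, linorder}) \<Rightarrow> 'a \<Rightarrow>\<^sub>L 'b"
  where "rk_pos_part h = Blinfun (\<lambda>x. rk_sup h (pprt x) - rk_sup h (- nprt x))"

lemma rk_bdd_above:
  fixes h :: "'a::banach_lattice \<Rightarrow>\<^sub>L 'b::{ordered_euclidean_space, linorder}"
  shows "bdd_above (blinfun_apply h ` {0..x})"
proof -
  obtain u :: 'b where u: "\<And>z c. norm z \<le> c \<longleftrightarrow> - (c *\<^sub>R u) \<le> z \<and> z \<le> c *\<^sub>R u"
    by (rule linorder_euclidean_unit) blast
  have "h y \<le> (norm h * norm x) *\<^sub>R u" if "y \<in> {0..x}" for y
  proof -
    have "norm (h y) \<le> norm h * norm y"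
      by (rule norm_blinfun)
    also have "\<dots> \<le> norm h * norm x"
      using that by (intro mult_left_mono norm_mono_pos) auto
    finally show ?thesis
      using u by blast
  qed
  then show ?thesis
    by (intro bdd_aboveI2) blast
qed

lemma rk_sup_upper: "0 \<le> y \<Longrightarrow> y \<le> x \<Longrightarrow> blinfun_apply h y \<le> rk_sup h x"
  unfolding rk_sup_def by (intro cSUP_upper rk_bdd_above) auto

lemma rk_sup_least:
  "0 \<le> x \<Longrightarrow> (\<And>y. 0 \<le> y \<Longrightarrow> y \<le> x \<Longrightarrow> blinfun_apply h y \<le> c) \<Longrightarrow> rk_sup h x \<le> c"
  unfolding rk_sup_def by (intro cSUP_least) auto

lemma rk_sup_nonneg: "0 \<le> x \<Longrightarrow> 0 \<le> rk_sup h x"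
  using rk_sup_upper[of 0 x h] by (simp add: blinfun.zero_right)

lemma rk_sup_add:
  assumes "0 \<le> x" "0 \<le> y"
  shows "rk_sup h (x + y) = rk_sup h x + rk_sup h y"
proof (rule antisym)
  show "rk_sup h (x + y) \<le> rk_sup h x + rk_sup h y"
  proof (rule rk_sup_least)
    fix z assume z: "0 \<le> z" "z \<le> x + y"
    have "z - y \<le> inf z x"
      using z assms by (simp add: diff_le_eq add.commute)
    then have "z - inf z x \<le> y"
      by (simp only: diff_le_eq) (simp add: add.commute)
    moreover have "0 \<le> z - inf z x"
      by (simp only: diff_ge_0_iff_ge inf_le1)
    ultimately have "h (inf z x) + h (z - inf z x) \<le> rk_sup h x + rk_sup h y"
      using z assms by (intro add_mono rk_sup_upper) simp_all
    then show "h z \<le> rk_sup h x + rk_sup h y"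
      by (simp only: blinfun.diff_right) simp
  qed (use assms in simp)
next
  have "rk_sup h x \<le> rk_sup h (x + y) - h b" if "0 \<le> b" "b \<le> y" for b
  proof (rule rk_sup_least)
    fix a assume "0 \<le> a" "a \<le> x"
    then have "h (a + b) \<le> rk_sup h (x + y)"
      using that by (intro rk_sup_upper add_mono) simp_all
    then show "h a \<le> rk_sup h (x + y) - h b"
      by (simp add: blinfun.add_right le_diff_eq)
  qed (use assms in simp)
  then have "rk_sup h y \<le> rk_sup h (x + y) - rk_sup h x"
    using assms by (intro rk_sup_least) (auto simp: le_diff_eq add.commute)
  then show "rk_sup h x + rk_sup h y \<le> rk_sup h (x + y)"
    by (simp add: le_diff_eq add.commute)
qed

lemma rk_sup_scaleR_le:
  assumes "0 \<le> x" "0 < r"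
  shows "rk_sup h (r *\<^sub>R x) \<le> r *\<^sub>R rk_sup h x"
proof (rule rk_sup_least)
  fix z assume z: "0 \<le> z" "z \<le> r *\<^sub>R x"
  have "inverse r *\<^sub>R z \<le> inverse r *\<^sub>R (r *\<^sub>R x)"
    using z assms by (intro scaleR_left_mono) auto
  then have "h (inverse r *\<^sub>R z) \<le> rk_sup h x"
    using z assms by (intro rk_sup_upper scaleR_nonneg_nonneg) auto
  then have "r *\<^sub>R h (inverse r *\<^sub>R z) \<le> r *\<^sub>R rk_sup h x"
    using assms by (intro scaleR_left_mono) auto
  then show "h z \<le> r *\<^sub>R rk_sup h x"
    using assms by (simp add: blinfun.scaleR_right)
qed (use assms in \<open>auto intro: scaleR_nonneg_nonneg\<close>)

lemma rk_sup_scaleR: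
  assumes "0 \<le> x" "0 \<le> r"
  shows "rk_sup h (r *\<^sub>R x) = r *\<^sub>R rk_sup h x"
proof (cases "r = 0")
  case True
  then show ?thesis
    by (simp add: rk_sup_def blinfun.zero_right)
next
  case False
  with assms have r: "0 < r"
    by simp
  have "rk_sup h (inverse r *\<^sub>R (r *\<^sub>R x)) \<le> inverse r *\<^sub>R rk_sup h (r *\<^sub>R x)"
    using assms r by (intro rk_sup_scaleR_le scaleR_nonneg_nonneg) auto
  then have "r *\<^sub>R rk_sup h x \<le> r *\<^sub>R (inverse r *\<^sub>R rk_sup h (r *\<^sub>R x))"
    using r by (intro scaleR_left_mono) auto
  then show ?thesis
    using r rk_sup_scaleR_le[OF assms(1) r, of h] by (intro antisym) auto
qed

lemma rk_sup_norm:
  fixes h :: "'a::banach_lattice \<Rightarrow>\<^sub>L 'b::{ordered_euclidean_space, linorder}"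
  assumes "0 \<le> x"
  shows "norm (rk_sup h x) \<le> norm h * norm x"
proof -
  obtain u :: 'b where u: "\<And>z c. norm z \<le> c \<longleftrightarrow> - (c *\<^sub>R u) \<le> z \<and> z \<le> c *\<^sub>R u"
    by (rule linorder_euclidean_unit) blast
  have "h y \<le> (norm h * norm x) *\<^sub>R u" if "0 \<le> y" "y \<le> x" for y
  proof -
    have "norm (h y) \<le> norm h * norm y"
      by (rule norm_blinfun)
    also have "\<dots> \<le> norm h * norm x"
      using that by (intro mult_left_mono norm_mono_pos) auto
    finally show ?thesis
      using u by blast
  qed
  then have "rk_sup h x \<le> (norm h * norm x) *\<^sub>R u"
    by (rule rk_sup_least[OF assms])
  moreover have "- ((norm h * norm x) *\<^sub>R u) \<le> 0"
    using u[of 0 "norm h * norm x"] by simp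
  ultimately show ?thesis
    using rk_sup_nonneg[OF assms, of h] unfolding u by (meson order_trans)
qed

lemma rk_sup_diff:
  assumes "0 \<le> a" "0 \<le> b" "0 \<le> c" "0 \<le> d" "a - b = c - d"
  shows "rk_sup h a - rk_sup h b = rk_sup h c - rk_sup h d"
proof -
  have "a + d = c + b"
    using assms(5) by (simp add: algebra_simps)
  then have "rk_sup h a + rk_sup h d = rk_sup h c + rk_sup h b"
    using assms(1-4) by (metis rk_sup_add)
  then show ?thesis
    by (simp add: algebra_simps)
qed

lemma pprt_minus_neg_nprt: "(x::'a::lattice_ab_group_add) = pprt x - (- nprt x)"
  using prts[of x] by simp

lemma rk_pos_part_apply:
  fixes h :: "'a::banach_lattice \<Rightarrow>\<^sub>L 'b::{ordered_euclidean_space, linorder}"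
  shows "rk_pos_part h x = rk_sup h (pprt x) - rk_sup h (- nprt x)"
proof -
  let ?P = "\<lambda>x. rk_sup h (pprt x) - rk_sup h (- nprt x)"
  have P: "?P (a - b) = rk_sup h a - rk_sup h b" if "0 \<le> a" "0 \<le> b" for a b
    using that pprt_minus_neg_nprt[of "a - b", symmetric]
    by (intro rk_sup_diff) simp_all
  have "bounded_linear ?P"
  proof (rule bounded_linear_intro)
    fix x y :: 'a
    have "x + y = (pprt x + pprt y) - (- nprt x + - nprt y)"
    proof -
      have "x + y = (pprt x - (- nprt x)) + (pprt y - (- nprt y))"
        by (simp only: pprt_minus_neg_nprt[symmetric])
      then show ?thesis
        by (rule trans) (rule add_diff_add[symmetric])
    qed
    then have "?P (x + y) = rk_sup h (pprt x + pprt y) - rk_sup h (- nprt x + - nprt y)"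
      by (simp only:) (rule P; intro add_nonneg_nonneg; simp)
    also have "\<dots> = ?P x + ?P y"
      by (subst (1 2) rk_sup_add) simp_all
    finally show "?P (x + y) = ?P x + ?P y" .
  next
    fix r :: real and x :: 'a
    show "?P (r *\<^sub>R x) = r *\<^sub>R ?P x"
    proof (cases "0 \<le> r")
      case True
      have "r *\<^sub>R x = r *\<^sub>R pprt x - r *\<^sub>R (- nprt x)"
        by (metis pprt_minus_neg_nprt scaleR_diff_right)
      then have "?P (r *\<^sub>R x) = rk_sup h (r *\<^sub>R pprt x) - rk_sup h (r *\<^sub>R (- nprt x))"
        using P[of "r *\<^sub>R pprt x" "r *\<^sub>R (- nprt x)"] True
        by (metis neg_0_le_iff_le nprt_le_zero scaleR_nonneg_nonneg zero_le_pprt)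
      also have "\<dots> = r *\<^sub>R ?P x"
        using True by (subst (1 2) rk_sup_scaleR) (simp_all add: algebra_simps)
      finally show ?thesis .
    next
      case False
      then have r: "0 \<le> - r"
        by simp
      have "r *\<^sub>R x = (- r) *\<^sub>R (- nprt x) - (- r) *\<^sub>R pprt x"
        using pprt_minus_neg_nprt[of x] 
        by (metis minus_diff_eq scaleR_diff_right scaleR_minus_left scaleR_minus_right)
      then have "?P (r *\<^sub>R x) = rk_sup h ((- r) *\<^sub>R (- nprt x)) - rk_sup h ((- r) *\<^sub>R pprt x)"
        using P[of "(- r) *\<^sub>R (- nprt x)" "(- r) *\<^sub>R pprt x"] r
        by (metis neg_0_le_iff_le nprt_le_zero scaleR_nonneg_nonneg zero_le_pprt)
      also have "\<dots> = (- r) *\<^sub>R rk_sup h (- nprt x) - (- r) *\<^sub>R rk_sup h (pprt x)"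
        by (simp only: rk_sup_scaleR[OF _ r] neg_0_le_iff_le nprt_le_zero zero_le_pprt)
      also have "\<dots> = r *\<^sub>R ?P x"
        by (simp add: algebra_simps)
      finally show ?thesis .
    qed
  next
    fix x :: 'a
    have "norm (?P x) \<le> norm (rk_sup h (pprt x)) + norm (rk_sup h (- nprt x))"
      by (rule norm_triangle_ineq4)
    also have "\<dots> \<le> norm h * norm (pprt x) + norm h * norm (- nprt x)"
      by (intro add_mono rk_sup_norm) simp_all
    also have "\<dots> \<le> norm h * norm x + norm h * norm x"
      unfolding norm_minus_cancel
      by (intro add_mono mult_left_mono norm_pprt_le norm_nprt_le norm_ge_zero)
    finally show "norm (?P x) \<le> norm x * (2 * norm h)"
      by (simp add: algebra_simps)
  qed
  then show ?thesis
    unfolding rk_pos_part_def by (simp add: bounded_linear_Blinfun_apply)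
qed

lemma rk_pos_part_pos: "0 \<le> x \<Longrightarrow> blinfun_apply (rk_pos_part h) x = rk_sup h x"
  by (simp add: rk_pos_part_apply rk_sup_def blinfun.zero_right)

instantiation blinfun ::
  (banach_lattice, "{ordered_euclidean_space, linorder}") lattice_ab_group_add_abs
begin

definition less_eq_blinfun :: "'a \<Rightarrow>\<^sub>L 'b \<Rightarrow> 'a \<Rightarrow>\<^sub>L 'b \<Rightarrow> bool"
  where "f \<le> g \<longleftrightarrow> (\<forall>x\<ge>0. blinfun_apply f x \<le> blinfun_apply g x)"

definition less_blinfun :: "'a \<Rightarrow>\<^sub>L 'b \<Rightarrow> 'a \<Rightarrow>\<^sub>L 'b \<Rightarrow> bool"
  where "f < g \<longleftrightarrow> f \<le> g \<and> \<not> g \<le> (f :: 'a \<Rightarrow>\<^sub>L 'b)"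

definition sup_blinfun :: "'a \<Rightarrow>\<^sub>L 'b \<Rightarrow> 'a \<Rightarrow>\<^sub>L 'b \<Rightarrow> 'a \<Rightarrow>\<^sub>L 'b"
  where "sup f g = f + rk_pos_part (g - f)"

definition inf_blinfun :: "'a \<Rightarrow>\<^sub>L 'b \<Rightarrow> 'a \<Rightarrow>\<^sub>L 'b \<Rightarrow> 'a \<Rightarrow>\<^sub>L 'b"
  where "inf f g = f - rk_pos_part (f - g)"

definition abs_blinfun :: "'a \<Rightarrow>\<^sub>L 'b \<Rightarrow> 'a \<Rightarrow>\<^sub>L 'b"
  where "\<bar>f\<bar> = sup f (- f :: 'a \<Rightarrow>\<^sub>L 'b)"

instance
proof
  fix f g k :: "'a \<Rightarrow>\<^sub>L 'b"
  have pos: "0 \<le> rk_pos_part h" for h :: "'a \<Rightarrow>\<^sub>L 'b"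
    by (simp add: less_eq_blinfun_def rk_pos_part_pos rk_sup_nonneg)
  have ge: "h \<le> rk_pos_part h" for h :: "'a \<Rightarrow>\<^sub>L 'b"
    by (simp add: less_eq_blinfun_def rk_pos_part_pos rk_sup_upper)
  have least: "rk_pos_part h \<le> k" if hk: "h \<le> k" and k: "0 \<le> k" for h k :: "'a \<Rightarrow>\<^sub>L 'b"
    unfolding less_eq_blinfun_def
  proof (intro allI impI)
    fix x :: 'a assume x: "0 \<le> x"
    have "h y \<le> k x" if y: "0 \<le> y" "y \<le> x" for y
    proof -
      have "0 \<le> k (x - y)"
        using k y by (simp add: less_eq_blinfun_def)
      then show ?thesis
        using hk y by (auto simp: less_eq_blinfun_def blinfun.diff_right intro: order_trans)
    qed
    then show "rk_pos_part h x \<le> k x"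
      using x by (simp add: rk_pos_part_pos rk_sup_least)
  qed
  have add: "f \<le> g \<Longrightarrow> k + f \<le> k + g" for f g k :: "'a \<Rightarrow>\<^sub>L 'b"
    by (simp add: less_eq_blinfun_def blinfun.add_left)
  show "f < g \<longleftrightarrow> f \<le> g \<and> \<not> g \<le> f"
    by (rule less_blinfun_def)
  show "f \<le> f"
    by (simp add: less_eq_blinfun_def)
  show "f \<le> g \<Longrightarrow> g \<le> k \<Longrightarrow> f \<le> k"
    by (auto simp: less_eq_blinfun_def intro: order_trans)
  show "f = g" if "f \<le> g" "g \<le> f"
  proof (rule blinfun_eqI)
    fix x
    have eq: "f y = g y" if "0 \<le> y" for y
      using that \<open>f \<le> g\<close> \<open>g \<le> f\<close> by (auto simp: less_eq_blinfun_def intro: antisym)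
    have "f (pprt x - (- nprt x)) = g (pprt x - (- nprt x))"
      by (simp only: blinfun.diff_right eq neg_0_le_iff_le nprt_le_zero zero_le_pprt)
    then show "f x = g x"
      by (simp only: pprt_minus_neg_nprt[symmetric])
  qed
  show "f \<le> g \<Longrightarrow> k + f \<le> k + g"
    by (rule add)
  show "inf f g \<le> f"
    using add[OF pos, of "f - rk_pos_part (f - g)" "f - g"] by (simp add: inf_blinfun_def)
  show "inf f g \<le> g"
    using add[OF ge, of "g - rk_pos_part (f - g)" "f - g"] by (simp add: inf_blinfun_def)
  show "k \<le> inf f g" if "k \<le> f" "k \<le> g"
  proof -
    have "f - g \<le> f - k"
      using add[OF that(2), of "f - g - k"] by simp
    moreover have "0 \<le> f - k"
      using add[OF that(1), of "- k"] by simp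
    ultimately have "rk_pos_part (f - g) \<le> f - k"
      by (rule least)
    from add[OF this, of "k - rk_pos_part (f - g)"] show ?thesis
      by (simp add: inf_blinfun_def)
  qed
  show "f \<le> sup f g"
    using add[OF pos, of f "g - f"] by (simp add: sup_blinfun_def)
  show "g \<le> sup f g"
    using add[OF ge, of f "g - f"] by (simp add: sup_blinfun_def)
  show "sup g k \<le> f" if "g \<le> f" "k \<le> f"
  proof -
    have "rk_pos_part (k - g) \<le> f - g"
      using add[OF that(1), of "- g"] add[OF that(2), of "- g"] by (intro least) simp_all
    from add[OF this, of g] show ?thesis
      by (simp add: sup_blinfun_def)
  qed
  show "\<bar>f\<bar> = sup f (- f)"
    by (rule abs_blinfun_def)
qed

end

lemma blinfun_le_abs:
  fixes f :: "'a::banach_lattice \<Rightarrow>\<^sub>L 'b::{ordered_euclidean_space, linorder}"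
  shows "f x \<le> \<bar>f\<bar> \<bar>x\<bar>"
proof -
  have pos: "f y \<le> \<bar>f\<bar> y" "- f y \<le> \<bar>f\<bar> y" if "0 \<le> y" for y
    using abs_ge_self[of f] abs_ge_minus_self[of f] that
    by (simp_all add: less_eq_blinfun_def blinfun.minus_left)
  have "f x = f (pprt x - (- nprt x))"
    by (simp only: pprt_minus_neg_nprt[symmetric])
  also have "\<dots> = f (pprt x) + (- f (- nprt x))"
    by (subst blinfun.diff_right) (rule diff_conv_add_uminus)
  also have "\<dots> \<le> \<bar>f\<bar> (pprt x) + \<bar>f\<bar> (- nprt x)"
    by (intro add_mono pos) simp_all
  also have "\<dots> = \<bar>f\<bar> \<bar>x\<bar>"
    by (simp add: abs_prts flip: blinfun.add_right)
  finally show ?thesis .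
qed

instance blinfun :: (banach_lattice, "{ordered_euclidean_space, linorder}") banach_lattice
proof
  fix f g :: "'a \<Rightarrow>\<^sub>L 'b" and a b :: real
  show "f \<le> g \<Longrightarrow> 0 \<le> a \<Longrightarrow> a *\<^sub>R f \<le> a *\<^sub>R g"
    by (auto simp: less_eq_blinfun_def blinfun.scaleR_left intro: scaleR_left_mono)
  show "a \<le> b \<Longrightarrow> 0 \<le> f \<Longrightarrow> a *\<^sub>R f \<le> b *\<^sub>R f"
    by (auto simp: less_eq_blinfun_def blinfun.scaleR_left intro: scaleR_right_mono)
  assume le: "\<bar>f\<bar> \<le> \<bar>g\<bar>"
  obtain u :: 'b where u: "\<And>z c. norm z \<le> c \<longleftrightarrow> - (c *\<^sub>R u) \<le> z \<and> z \<le> c *\<^sub>R u"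
    by (rule linorder_euclidean_unit) blast
  have g_le: "\<bar>g\<bar> x \<le> (norm g * norm x) *\<^sub>R u" if x: "0 \<le> x" for x
  proof -
    have "rk_sup (- g - g) x \<le> (norm g * norm x) *\<^sub>R u - g x"
    proof (rule rk_sup_least[OF x])
      fix y assume y: "0 \<le> y" "y \<le> x"
      have "x - y - y \<le> x" "- (x - y - y) \<le> x"
        using y add_mono[OF y(2) y(2)] add_mono[OF y(1) y(1)] by (simp_all add: algebra_simps)
      then have "\<bar>x - y - y\<bar> \<le> x"
        by (simp add: abs_le_iff)
      then have "norm (x - y - y) \<le> norm x"
        using x by (intro norm_mono_abs) simp
      then have "norm (g (x - y - y)) \<le> norm g * norm x"
        by (meson mult_left_mono norm_blinfun norm_ge_zero order_trans)
      then have "g (x - y - y) \<le> (norm g * norm x) *\<^sub>R u"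
        using u by blast
      moreover have "g (x - y - y) = (- g - g) y + g x"
        by (simp add: blinfun.diff_right blinfun.diff_left blinfun.minus_left)
      ultimately show "(- g - g) y \<le> (norm g * norm x) *\<^sub>R u - g x"
        by (simp only: le_diff_eq)
    qed
    then show ?thesis
      using x by (simp add: abs_blinfun_def sup_blinfun_def blinfun.add_left rk_pos_part_pos
          algebra_simps)
  qed
  have f_le: "f x \<le> (norm g * norm x) *\<^sub>R u" for x
  proof -
    have "f x \<le> \<bar>f\<bar> \<bar>x\<bar>"
      by (rule blinfun_le_abs)
    also have "\<dots> \<le> \<bar>g\<bar> \<bar>x\<bar>"
      using le by (simp add: less_eq_blinfun_def)
    also have "\<dots> \<le> (norm g * norm \<bar>x\<bar>) *\<^sub>R u"
      by (rule g_le) simp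
    finally show ?thesis
      by simp
  qed
  have "norm (f x) \<le> norm g * norm x" for x
    using f_le[of x] f_le[of "- x"] unfolding u by (simp add: blinfun.minus_right minus_le_iff)
  then show "norm f \<le> norm g"
    by (intro norm_blinfun_bound) simp_all
qed


section \<open>Order continuous norms\<close>

text \<open>
  A net decreasing to \<open>0\<close> is represented by its range, a nonempty downward directed set with
  infimum \<open>0\<close>; conversely such a set is a decreasing net indexed by itself.
\<close>

definition order_continuous_norm :: "'a::banach_lattice itself \<Rightarrow> bool"
  where "order_continuous_norm _ \<longleftrightarrow>
    (\<forall>D::'a set. D \<noteq> {} \<longrightarrow>
      (\<forall>x\<in>D. \<forall>y\<in>D. \<exists>z\<in>D. z \<le> x \<and> z \<le> y) \<longrightarrow>
      (\<forall>x\<in>D. 0 \<le> x) \<longrightarrow>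
      (\<forall>l. (\<forall>x\<in>D. l \<le> x) \<longrightarrow> l \<le> 0) \<longrightarrow>
      (INF x\<in>D. norm x) = 0)"


section \<open>Sequences\<close>

definition disjoint_seq :: "(nat \<Rightarrow> 'a::banach_lattice) \<Rightarrow> bool"
  where "disjoint_seq x \<longleftrightarrow> (\<forall>m n. m \<noteq> n \<longrightarrow> inf \<bar>x m\<bar> \<bar>x n\<bar> = 0)"

definition weakly_null :: "(nat \<Rightarrow> 'a::real_normed_vector) \<Rightarrow> bool"
  where "weakly_null x \<longleftrightarrow> (\<forall>f::'a \<Rightarrow>\<^sub>L real. (\<lambda>n. blinfun_apply f (x n)) \<longlonglongrightarrow> 0)"

definition weak_star_null :: "(nat \<Rightarrow> 'a::real_normed_vector \<Rightarrow>\<^sub>L real) \<Rightarrow> bool"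
  where "weak_star_null f \<longleftrightarrow> (\<forall>x. (\<lambda>n. blinfun_apply (f n) x) \<longlonglongrightarrow> 0)"

definition norm_null :: "(nat \<Rightarrow> 'a::real_normed_vector) \<Rightarrow> bool"
  where "norm_null x \<longleftrightarrow> x \<longlonglongrightarrow> 0"


section \<open>Operators\<close>

text \<open>
  The Banach space adjoint \<open>S\<^sup>*f = f \<circ> S\<close>. It is only meaningful for bounded \<open>S\<close>
  (see \<open>banach_adjoint_apply\<close>); positive operators between Banach lattices are bounded
  (see \<open>positive_operator_bounded_linear\<close>).
\<close>

definition banach_adjoint ::
  "('a::real_normed_vector \<Rightarrow> 'b::real_normed_vector) \<Rightarrow> ('b \<Rightarrow>\<^sub>L real) \<Rightarrow> ('a \<Rightarrow>\<^sub>L real)"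
  where "banach_adjoint S f = Blinfun (\<lambda>x. blinfun_apply f (S x))"

definition positive_operator :: "('a::banach_lattice \<Rightarrow> 'b::banach_lattice) \<Rightarrow> bool"
  where "positive_operator T \<longleftrightarrow> linear T \<and> (\<forall>x\<ge>0. 0 \<le> T x)"

definition almost_Dunford_Pettis :: "('a::banach_lattice \<Rightarrow> 'b::banach) \<Rightarrow> bool"
  where "almost_Dunford_Pettis T \<longleftrightarrow> linear T \<and>
    (\<forall>x. disjoint_seq x \<longrightarrow> weakly_null x \<longrightarrow> norm_null (\<lambda>n. T (x n)))"

definition positively_limited :: "('a::banach \<Rightarrow> 'b::banach_lattice) \<Rightarrow> bool"
  where "positively_limited S \<longleftrightarrow> bounded_linear S \<and>
    (\<forall>f::nat \<Rightarrow> 'b \<Rightarrow>\<^sub>L real. (\<forall>n. 0 \<le> f n) \<longrightarrow> weak_star_null f \<longrightarrow>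
      norm_null (\<lambda>n. banach_adjoint S (f n)))"

definition almost_limited :: "('a::banach \<Rightarrow> 'b::banach_lattice) \<Rightarrow> bool"
  where "almost_limited S \<longleftrightarrow> bounded_linear S \<and>
    (\<forall>f::nat \<Rightarrow> 'b \<Rightarrow>\<^sub>L real. disjoint_seq f \<longrightarrow> weak_star_null f \<longrightarrow>
      norm_null (\<lambda>n. banach_adjoint S (f n)))"

lemma banach_adjoint_apply:
  assumes "bounded_linear S"
  shows "blinfun_apply (banach_adjoint S f) x = blinfun_apply f (S x)"
  unfolding banach_adjoint_def
  using bounded_linear_compose[OF blinfun.bounded_linear_right assms]
  by (subst bounded_linear_Blinfun_apply) simp_all

lemma positive_operator_mono:
  assumes "positive_operator T" "x \<le> y"
  shows "T x \<le> T y"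
proof -
  have "0 \<le> T (y - x)"
    using assms by (simp add: positive_operator_def)
  then show ?thesis
    using assms by (simp add: positive_operator_def linear_diff)
qed

lemma positive_operator_bounded_linear:
  fixes T :: "'a::banach_lattice \<Rightarrow> 'b::banach_lattice"
  assumes T: "positive_operator T"
  shows "bounded_linear T"
proof -
  have lin: "linear T"
    using T by (simp add: positive_operator_def)
  have "\<exists>K. \<forall>x\<ge>0. norm (T x) \<le> norm x * K"
  proof (rule ccontr)
    assume "\<not> ?thesis"
    then have "\<forall>n::nat. \<exists>x\<ge>0. norm (T x) > norm x * (real n * 2 ^ n)"
      by (meson not_le)
    then obtain x where x: "\<And>n. 0 \<le> x n" "\<And>n. norm (T (x n)) > norm (x n) * (real n * 2 ^ n)"
      by metis
    have nz: "0 < norm (x n)" for n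
      using x(2)[of n] lin by (cases "x n = 0") (auto simp: linear_0)
    define y where "y n = ((1/2) ^ n / norm (x n)) *\<^sub>R x n" for n
    have y_pos: "0 \<le> y n" for n
      unfolding y_def by (intro scaleR_nonneg_nonneg x) simp
    have norm_y: "norm (y n) = (1/2) ^ n" for n
      using nz[of n] by (simp add: y_def)
    have T_y: "real n \<le> norm (T (y n))" for n
    proof -
      have "real n = ((1/2) ^ n / norm (x n)) * (norm (x n) * (real n * 2 ^ n))"
        using nz[of n] by (simp add: field_simps)
      also have "\<dots> \<le> ((1/2) ^ n / norm (x n)) * norm (T (x n))"
        using x(2)[of n] by (intro mult_left_mono) auto
      also have "\<dots> = norm (T (y n))"
        using lin by (simp add: y_def linear_scale)
      finally show ?thesis .
    qed
    have summ: "summable (\<lambda>n. norm (y n))"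
      by (simp add: norm_y summable_geometric)
    define s where "s = (\<Sum>n. y n)"
    have lim: "(\<lambda>n. \<Sum>i<n. y i) \<longlonglongrightarrow> s"
      using summable_norm_cancel[OF summ] unfolding s_def by (rule summable_LIMSEQ)
    have part: "y n \<le> (\<Sum>i<m. y i)" if "n < m" for n m
    proof -
      have "y n = sum y {n}"
        by simp
      also have "\<dots> \<le> (\<Sum>i<m. y i)"
        using that y_pos by (intro sum_mono2) auto
      finally show ?thesis .
    qed
    have nprt_norm: "norm (nprt (a + b)) \<le> norm b" if "0 \<le> a" for a b :: 'a
    proof -
      have "nprt b \<le> nprt (a + b)"
        using that by (intro nprt_mono) simp
      then have "- nprt (a + b) \<le> - nprt b"
        by simp
      then have "norm (- nprt (a + b)) \<le> norm (- nprt b)"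
        by (intro norm_mono_pos) simp_all
      then show ?thesis
        using norm_nprt_le[of b] by simp
    qed
    have y_le_s: "y n \<le> s" for n
    proof -
      have "norm (nprt (s - y n)) \<le> norm (s - (\<Sum>i<m. y i))" if "n < m" for m
        using nprt_norm[of "(\<Sum>i<m. y i) - y n" "s - (\<Sum>i<m. y i)"] part[OF that] by simp
      then have ev: "\<forall>\<^sub>F m in sequentially. norm (nprt (s - y n)) \<le> norm (s - (\<Sum>i<m. y i))"
        using eventually_gt_at_top by (rule eventually_mono[rotated])
      have "(\<lambda>m. norm (s - (\<Sum>i<m. y i))) \<longlonglongrightarrow> norm (s - s)"
        by (intro tendsto_intros lim)
      then have "norm (nprt (s - y n)) \<le> norm (s - s)"
        using ev by (rule tendsto_lowerbound) simp
      then have "nprt (s - y n) = 0"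
        by simp
      then show ?thesis
        by (simp flip: zero_le_iff_zero_nprt)
    qed
    have "real n \<le> norm (T s)" for n
    proof -
      have "0 \<le> T (y n)"
        using T y_pos by (simp add: positive_operator_def)
      then have "norm (T (y n)) \<le> norm (T s)"
        using positive_operator_mono[OF T y_le_s] by (rule norm_mono_pos)
      then show ?thesis
        using T_y[of n] by simp
    qed
    then show False
      by (meson not_le reals_Archimedean2)
  qed
  then obtain K where K: "\<And>x. 0 \<le> x \<Longrightarrow> norm (T x) \<le> norm x * K"
    by blast
  have "norm (T x) \<le> norm x * K" for x
  proof -
    have "T x \<le> T \<bar>x\<bar>" "- T x \<le> T \<bar>x\<bar>"
      using positive_operator_mono[OF T, of x "\<bar>x\<bar>"] positive_operator_mono[OF T, of "- x" "\<bar>x\<bar>"]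
      by (simp_all add: abs_ge_self abs_ge_minus_self linear_neg[OF lin])
    then have "\<bar>T x\<bar> \<le> T \<bar>x\<bar>"
      by (simp add: abs_le_iff)
    then have "norm (T x) \<le> norm (T \<bar>x\<bar>)"
      by (intro norm_mono_abs) (meson abs_ge_self order_trans)
    also have "\<dots> \<le> norm x * K"
      using K[of "\<bar>x\<bar>"] by simp
    finally show ?thesis .
  qed
  then show ?thesis
    using lin by (simp add: bounded_linear_def bounded_linear_axioms_def) blast
qed

end

theory Submission
  imports Defs
begin

text \<open>
  Write \<open>E\<close>, \<open>F\<close> for the two lattices. The point is that \<open>T\<^sup>*\<close> maps the unit ball of \<open>F\<^sup>*\<close> into
  an order interval of \<open>E\<^sup>*\<close> up to an arbitrarily small norm error: for every \<open>d > 0\<close> there is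
  \<open>g \<ge> 0\<close> in \<open>E\<^sup>*\<close> with \<open>\<parallel>(T\<^sup>*f - g)\<^sup>+\<parallel> \<le> d\<close> for all positive \<open>f\<close> in the unit ball. Every
  \<open>\<phi>\<close> in \<open>E\<^sup>*\<^sup>*\<close> then satisfies \<open>\<parallel>T\<^sup>*\<^sup>*\<phi>\<parallel> \<le> \<bar>\<phi>\<bar> g + d \<parallel>\<phi>\<parallel>\<close>, so bounded sequences whose moduli are
  weak* null go to norm null sequences. Weak* null sequences are bounded by the uniform
  boundedness principle, and moduli are weak* null in both cases of interest: trivially for
  positive sequences, and for disjoint sequences because on a lattice with order continuous norm
  every bounded disjoint sequence of functionals has weak* null moduli. Weakly null sequences in
  \<open>E\<^sup>*\<^sup>*\<close> are weak* null, which gives the statement on \<open>T\<^sup>*\<^sup>*\<close>.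

  Order continuity of a norm enters through the convergence of increasing order bounded sequences,
  and this in turn through one lemma, \<open>almost_biorthogonal_null\<close>: if \<open>b\<^sub>n\<close> lies in a fixed order
  interval, the \<open>f\<^sub>n\<close> are positive and bounded, and \<open>f\<^sub>i b\<^sub>n\<close> for \<open>i < n\<close> is geometrically small in
  \<open>n\<close>, then \<open>f\<^sub>n b\<^sub>n\<close> tends to \<open>0\<close>.

  The functional \<open>g\<close> is found in three steps. First, \<open>E\<^sup>*\<close> having order continuous norm, positive
  bounded disjoint sequences of \<open>E\<close> are weakly null: their canonical images in \<open>E\<^sup>*\<^sup>*\<close> are bounded disjoint
  functionals on \<open>E\<^sup>*\<close>. So \<open>T\<close> maps them to norm null sequences. Second, a disjointification
  argument turns this into: for every \<open>e\<close> there is \<open>u \<ge> 0\<close> in \<open>E\<close> with \<open>\<parallel>T (x - u)\<^sup>+\<parallel> \<le> e\<close> on the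
  positive unit ball. Third, if no \<open>g\<close> works for \<open>d\<close>, one selects recursively positive \<open>f\<^sub>n\<close> and
  \<open>a\<^sub>n\<close> in the unit balls with \<open>T\<^sup>*f\<^sub>n a\<^sub>n > d\<close> and \<open>T\<^sup>*f\<^sub>i a\<^sub>n\<close> small for \<open>i < n\<close>. The elements
  \<open>T (a\<^sub>n \<and> u)\<close> stay in the order interval \<open>[0, T u]\<close> of \<open>F\<close>, whose norm is order continuous, and
  \<open>f\<^sub>n\<close> is at least \<open>d/2\<close> on them. This contradicts \<open>almost_biorthogonal_null\<close>.
\<close>

section \<open>Order and norm limits\<close>

text \<open>
  The positive cone is norm closed because the negative part of \<open>l\<close> is dominated by that of
  \<open>l - x\<^sub>n\<close>, which tends to \<open>0\<close> in norm.
\<close>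

lemma tendsto_nonneg_lattice:
  fixes x :: "nat \<Rightarrow> 'a::banach_lattice"
  assumes lim: "x \<longlonglongrightarrow> l" and nonneg: "\<And>n. 0 \<le> x n"
  shows "0 \<le> l"
proof -
  have "norm (nprt l) \<le> norm (l - x n)" for n
  proof -
    have "nprt (l - x n) \<le> nprt l"
      using nonneg[of n] by (intro nprt_mono) simp
    then have "- nprt l \<le> - nprt (l - x n)"
      by simp
    then have "norm (- nprt l) \<le> norm (- nprt (l - x n))"
      by (intro norm_mono_pos) simp_all
    then show ?thesis
      using norm_nprt_le[of "l - x n"] by simp
  qed
  moreover have "(\<lambda>n. norm (l - x n)) \<longlonglongrightarrow> norm (l - l)"
    by (intro tendsto_intros lim)
  ultimately have "norm (nprt l) \<le> 0"
    using LIMSEQ_le_const by fastforce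
  then show ?thesis
    by (simp add: zero_le_iff_zero_nprt)
qed

lemma tendsto_le_lattice:
  fixes x y :: "nat \<Rightarrow> 'a::banach_lattice"
  assumes "x \<longlonglongrightarrow> a" "y \<longlonglongrightarrow> b" "\<And>n. x n \<le> y n"
  shows "a \<le> b"
proof -
  have "0 \<le> b - a"
    by (rule tendsto_nonneg_lattice[OF tendsto_diff[OF assms(2,1)]]) (simp add: assms(3))
  then show ?thesis by simp
qed

lemma nonpos_if_multiples_bounded:
  fixes l z :: "'a::banach_lattice"
  assumes le: "\<And>k::nat. real k *\<^sub>R l \<le> z"
  shows "l \<le> 0"
proof -
  have "l \<le> inverse (real (Suc k)) *\<^sub>R z" for k
  proof -
    have "inverse (real (Suc k)) *\<^sub>R (real (Suc k) *\<^sub>R l) \<le> inverse (real (Suc k)) *\<^sub>R z"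
      by (intro scaleR_left_mono le) simp
    then show ?thesis
      by (simp del: of_nat_Suc)
  qed
  moreover have "(\<lambda>k. inverse (real (Suc k)) *\<^sub>R z) \<longlonglongrightarrow> 0 *\<^sub>R z"
    by (intro tendsto_intros LIMSEQ_inverse_real_of_nat)
  ultimately show ?thesis
    using tendsto_le_lattice[OF tendsto_const] by fastforce
qed

lemma le_suminf:
  fixes x :: "nat \<Rightarrow> 'a::banach_lattice"
  assumes "summable x" "\<And>n. 0 \<le> x n"
  shows "x n \<le> suminf x"
proof (rule tendsto_le_lattice[OF tendsto_const])
  show "(\<lambda>k. \<Sum>i<n + Suc k. x i) \<longlonglongrightarrow> suminf x"
    using LIMSEQ_ignore_initial_segment[OF summable_LIMSEQ[OF assms(1)], of "Suc n"]
    by (simp add: add.commute)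
  fix k
  have "sum x {n} \<le> (\<Sum>i<n + Suc k. x i)"
    by (intro sum_mono2) (auto simp: assms)
  then show "x n \<le> (\<Sum>i<n + Suc k. x i)" by simp
qed

text \<open>
  The differences between the upper bounds of the sequence and its members are directed downward.
  A lower bound \<open>l\<close> of these differences can be subtracted from any upper bound and leaves an
  upper bound; iterating, all multiples of \<open>l\<close> are bounded above, so \<open>l \<le> 0\<close>. Order continuity then
  provides an upper bound and a member at small distance, which makes the sequence Cauchy. No
  supremum has to be known in advance.
\<close>

lemma order_continuous_norm_incseq_convergent:
  fixes x :: "nat \<Rightarrow> 'a::banach_lattice"
  assumes oc: "order_continuous_norm TYPE('a)"
    and inc: "\<And>m n. m \<le> n \<Longrightarrow> x m \<le> x n" and ub: "\<And>n. x n \<le> w"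
  shows "convergent x"
proof -
  define U where "U = {y. \<forall>n. x n \<le> y}"
  define D where "D = {y - x n |y n. y \<in> U}"
  have dir: "\<exists>z\<in>D. z \<le> d1 \<and> z \<le> d2" if "d1 \<in> D" "d2 \<in> D" for d1 d2
  proof -
    obtain y1 n1 y2 n2 where d: "d1 = y1 - x n1" "d2 = y2 - x n2" "y1 \<in> U" "y2 \<in> U"
      using \<open>d1 \<in> D\<close> \<open>d2 \<in> D\<close> unfolding D_def by blast
    have "inf y1 y2 \<in> U"
      using d unfolding U_def by simp
    then have "inf y1 y2 - x (max n1 n2) \<in> D"
      unfolding D_def by blast
    moreover have "inf y1 y2 - x (max n1 n2) \<le> d1" "inf y1 y2 - x (max n1 n2) \<le> d2"
      unfolding d by (intro diff_mono inf_le1 inf_le2 inc; simp)+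
    ultimately show ?thesis by blast
  qed
  have inf0: "l \<le> 0" if l: "\<forall>d\<in>D. l \<le> d" for l
  proof -
    have step: "y - l \<in> U" if "y \<in> U" for y
      unfolding U_def
    proof safe
      fix n
      have "l \<le> y - x n" using l that unfolding D_def by blast
      then show "x n \<le> y - l" by (simp add: algebra_simps)
    qed
    have "w - real k *\<^sub>R l \<in> U" for k
    proof (induction k)
      case 0
      then show ?case using ub unfolding U_def by simp
    next
      case (Suc k)
      from step[OF this] show ?case by (simp add: algebra_simps)
    qed
    then have "real k *\<^sub>R l \<le> w - x 0" for k
      unfolding U_def by (simp add: algebra_simps)
    then show ?thesis by (rule nonpos_if_multiples_bounded)
  qed
  have "w - x 0 \<in> D" using ub unfolding D_def U_def by blast
  moreover have "0 \<le> d" if "d \<in> D" for d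
    using that unfolding D_def U_def by auto
  ultimately have INF0: "(INF d\<in>D. norm d) = 0"
    using dir inf0 by (intro oc[unfolded order_continuous_norm_def, THEN spec, of D, THEN mp, THEN mp, THEN mp, THEN mp]) auto
  have "Cauchy x"
  proof (rule CauchyI)
    fix e :: real assume "0 < e"
    have "\<exists>d\<in>D. norm d < e / 2"
    proof (rule ccontr)
      assume "\<not> ?thesis"
      then have "e / 2 \<le> (INF d\<in>D. norm d)"
        using \<open>w - x 0 \<in> D\<close> by (intro cINF_greatest) (auto simp: not_less)
      then show False using INF0 \<open>0 < e\<close> by simp
    qed
    then obtain y N where y: "y \<in> U" and N: "norm (y - x N) < e / 2"
      unfolding D_def by blast
    have close: "norm (x m - x N) < e / 2" if "N \<le> m" for m
    proof -
      have "norm (x m - x N) \<le> norm (y - x N)"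
        using inc[OF that] y unfolding U_def by (intro norm_mono_pos) auto
      then show ?thesis using N by simp
    qed
    show "\<exists>M. \<forall>m\<ge>M. \<forall>n\<ge>M. norm (x m - x n) < e"
    proof (intro exI allI impI)
      fix m n assume "N \<le> m" "N \<le> n"
      then show "norm (x m - x n) < e"
        using norm_triangle_ineq4[of "x m - x N" "x n - x N"] close[of m] close[of n] by simp
    qed
  qed
  then show ?thesis by (rule Cauchy_convergent)
qed

section \<open>Disjoint elements\<close>

lemma inf_add_le:
  fixes a b c :: "'a::lattice_ab_group_add"
  assumes "0 \<le> a" "0 \<le> b" "0 \<le> c"
  shows "inf (a + b) c \<le> inf a c + inf b c"
proof -
  have "inf (a + b) c \<le> a + inf b c"
    using assms by (simp add: add_inf_distrib_left le_infI2 add_increasing)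
  moreover have "inf (a + b) c \<le> c + inf b c"
    using assms by (simp add: le_infI2 add_increasing2)
  ultimately have "inf (a + b) c \<le> inf (a + inf b c) (c + inf b c)"
    by simp
  then show ?thesis by (simp only: add_inf_distrib_right)
qed

lemma inf_sum_eq_0:
  fixes a :: "nat \<Rightarrow> 'a::lattice_ab_group_add"
  assumes "finite I" "\<And>i. i \<in> I \<Longrightarrow> 0 \<le> a i" "\<And>i. i \<in> I \<Longrightarrow> inf (a i) c = 0" "0 \<le> c"
  shows "inf (\<Sum>i\<in>I. a i) c = 0"
  using assms
proof (induction I rule: finite_induct)
  case empty
  then show ?case by (simp add: inf_absorb1)
next
  case (insert i I)
  have "inf (a i + (\<Sum>i\<in>I. a i)) c \<le> inf (a i) c + inf (\<Sum>i\<in>I. a i) c"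
    using insert.prems by (intro inf_add_le sum_nonneg) auto
  also have "\<dots> = 0" using insert by simp
  finally have "inf (a i + (\<Sum>i\<in>I. a i)) c \<le> 0" .
  moreover have "0 \<le> inf (a i + (\<Sum>i\<in>I. a i)) c"
    using insert.prems by (auto intro!: add_nonneg_nonneg sum_nonneg)
  ultimately show ?case using insert.hyps by (simp add: antisym)
qed

lemma inf_pprt_neg: "inf (pprt z) (pprt (- z)) = (0::'a::lattice_ab_group_add)"
proof -
  have "pprt z = z + pprt (- z)"
    using prts[of z] unfolding pprt_neg by (metis add_diff_cancel_right' diff_conv_add_uminus)
  then have "inf (pprt z) (pprt (- z)) = inf (z + pprt (- z)) (0 + pprt (- z))"
    by simp
  also have "\<dots> = nprt z + pprt (- z)"
    by (simp only: add_inf_distrib_right[symmetric] nprt_def)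
  finally show ?thesis by (simp add: pprt_neg)
qed

lemma inf_plus_pprt_diff: "a = inf a u + pprt (a - u)"
  for a u :: "'a::lattice_ab_group_add"
proof -
  have "pprt (a - u) + u = sup a u"
    by (simp add: pprt_def add_sup_distrib_right)
  then have "a + u = (inf a u + pprt (a - u)) + u"
    using add_eq_inf_sup[of a u] by (simp add: ac_simps)
  then show ?thesis by simp
qed

text \<open>
  The source of disjoint sequences below: subtracting from \<open>v\<close> a large multiple of \<open>w\<close> and from
  \<open>w\<close> the reciprocal multiple of \<open>v\<close> leaves disjoint positive parts, since up to a positive factor
  both are parts of the same element and its negative.
\<close>

lemma inf_pprt_diff_scaled:
  fixes v w :: "'a::banach_lattice"
  assumes "1 \<le> c"
  shows "inf (pprt (v - c *\<^sub>R w)) (pprt (w - (1 / c) *\<^sub>R v)) = 0"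
proof (rule antisym)
  let ?z = "v - c *\<^sub>R w"
  have "w - (1 / c) *\<^sub>R v = (1 / c) *\<^sub>R (- ?z)"
    using assms by (simp add: algebra_simps)
  also have "\<dots> \<le> (1 / c) *\<^sub>R pprt (- ?z)"
    using assms by (intro scaleR_left_mono) (auto simp: pprt_def)
  also have "\<dots> \<le> 1 *\<^sub>R pprt (- ?z)"
    using assms by (intro scaleR_right_mono) auto
  finally have "pprt (w - (1 / c) *\<^sub>R v) \<le> pprt (- ?z)"
    unfolding pprt_def[of "w - _"] by simp
  then have "inf (pprt ?z) (pprt (w - (1 / c) *\<^sub>R v)) \<le> inf (pprt ?z) (pprt (- ?z))"
    by (intro inf_mono) auto
  then show "inf (pprt ?z) (pprt (w - (1 / c) *\<^sub>R v)) \<le> 0"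
    by (simp only: inf_pprt_neg)
qed simp

section \<open>Bounded functionals\<close>

lemma blinfun_mono:
  fixes f :: "'a::banach_lattice \<Rightarrow>\<^sub>L real"
  assumes "0 \<le> f" "x \<le> y" shows "f x \<le> f y"
proof -
  have "0 \<le> f (y - x)"
    using assms by (simp add: less_eq_blinfun_def)
  then show ?thesis by (simp add: blinfun.diff_right)
qed

lemma blinfun_nonneg:
  fixes f :: "'a::banach_lattice \<Rightarrow>\<^sub>L real"
  assumes "0 \<le> f" "0 \<le> x" shows "0 \<le> f x"
  using assms by (simp add: less_eq_blinfun_def)

lemma abs_blinfun_apply_le:
  fixes f :: "'a::banach_lattice \<Rightarrow>\<^sub>L real"
  shows "\<bar>f x\<bar> \<le> norm f * norm x"
  using norm_blinfun[of f x] by simp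

lemma pprt_blinfun: "pprt f = rk_pos_part f"
  unfolding pprt_def by (subst sup.commute) (simp add: sup_blinfun_def)

text \<open>
  The norm of a positive functional can be computed on the positive part of the unit ball,
  because passing from \<open>z\<close> to \<open>\<bar>z\<bar>\<close> increases the value and preserves the norm.
\<close>

lemma positive_functional_norm_witness:
  fixes f :: "'a::banach_lattice \<Rightarrow>\<^sub>L real"
  assumes f: "0 \<le> f" and d: "0 \<le> d" "d < norm f"
  obtains x where "0 \<le> x" "norm x \<le> 1" "d < f x"
proof -
  have "\<exists>x\<ge>0. norm x \<le> 1 \<and> d < f x"
  proof (rule ccontr)
    assume *: "\<not> ?thesis"
    have "norm f \<le> d"
    proof (rule norm_blinfun_bound[OF d(1)])
      fix z
      have "norm (f z) \<le> f \<bar>z\<bar>"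
        using blinfun_mono[OF f abs_ge_self, of z] blinfun_mono[OF f abs_ge_minus_self, of z]
        by (simp add: blinfun.minus_right abs_le_iff)
      also have "\<dots> \<le> d * norm z"
      proof (cases "z = 0")
        case False
        have "0 \<le> (1 / norm z) *\<^sub>R \<bar>z\<bar>" "norm ((1 / norm z) *\<^sub>R \<bar>z\<bar>) \<le> 1"
          using False by (simp_all add: scaleR_nonneg_nonneg)
        then have "f ((1 / norm z) *\<^sub>R \<bar>z\<bar>) \<le> d"
          using * not_le by blast
        then show ?thesis using False by (simp add: blinfun.scaleR_right field_simps)
      qed (simp add: blinfun.zero_right)
      finally show "norm (f z) \<le> d * norm z" .
    qed
    then show False using d by simp
  qed
  then show thesis using that by blast
qed

text \<open>
  The value at \<open>x\<close> of the infimum of two functionals is the infimum of \<open>f (x - a) + h a\<close> over all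
  \<open>a\<close> between \<open>0\<close> and \<open>x\<close>; so disjoint functionals nearly live on complementary pieces of \<open>x\<close>.
\<close>

lemma dual_disjoint_split:
  fixes f h :: "'a::banach_lattice \<Rightarrow>\<^sub>L real"
  assumes "inf f h = 0" "0 \<le> x" "0 < e"
  shows "\<exists>a\<ge>0. a \<le> x \<and> f (x - a) + h a < e"
proof (rule ccontr)
  assume "\<not> ?thesis"
  then have *: "e \<le> f (x - a) + h a" if "0 \<le> a" "a \<le> x" for a
    using that by (auto simp: not_less)
  have "rk_sup (f - h) x \<le> f x - e"
    using assms(2) * by (intro rk_sup_least)
      (auto simp: blinfun.diff_left blinfun.diff_right algebra_simps)
  moreover have "rk_sup (f - h) x = f x"
    using arg_cong[OF assms(1), of "\<lambda>g. g x"] assms(2)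
    by (simp add: inf_blinfun_def blinfun.diff_left rk_pos_part_pos blinfun.zero_left)
  ultimately show False using assms(3) by simp
qed

text \<open>
  By the Baire category theorem one of the closed sets on which all \<open>f\<^sub>n\<close> are bounded by \<open>k\<close>
  contains a ball, and the difference of two points of the ball reaches every direction.
\<close>

lemma uniform_boundedness:
  fixes f :: "nat \<Rightarrow> 'a::banach \<Rightarrow>\<^sub>L 'b::real_normed_vector"
  assumes bdd: "\<And>x. Bseq (\<lambda>n. f n x)"
  obtains C where "\<And>n. norm (f n) \<le> C"
proof -
  define A where "A k = {x. \<forall>n. norm (f n x) \<le> real k}" for k :: nat
  have closed: "closed (A k)" for k
    unfolding A_def by (intro closed_Collect_all closed_Collect_le continuous_intros)
  have "\<exists>k. interior (A k) \<noteq> {}"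
  proof (rule ccontr)
    assume "\<not> ?thesis"
    then have "euclidean interior_of \<Union>(range A) = {}"
      using closed
      by (intro Baire_category_alt) (auto simp: completely_metrizable_space_euclidean)
    moreover have "\<Union>(range A) = UNIV"
    proof -
      have "x \<in> \<Union>(range A)" for x
      proof -
        obtain K where "\<And>n. norm (f n x) \<le> K"
          using bdd[of x] unfolding Bseq_def by blast
        then have "x \<in> A (nat \<lceil>K\<rceil>)"
          unfolding A_def by (auto intro: order_trans of_nat_ceiling)
        then show ?thesis by blast
      qed
      then show ?thesis by blast
    qed
    ultimately show False by simp
  qed
  then obtain k z r where r: "0 < r" "cball z r \<subseteq> A k"
    by (metis all_not_in_conv mem_interior_cball)
  have "norm (f n) \<le> 2 * real k / r" for n
  proof (rule norm_blinfun_bound)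
    fix x
    show "norm (f n x) \<le> 2 * real k / r * norm x"
    proof (cases "x = 0")
      case False
      define y where "y = (r / norm x) *\<^sub>R x"
      have "norm y = r" using False r by (simp add: y_def)
      then have "z + y \<in> A k" "z \<in> A k"
        using r by (auto simp: dist_norm intro!: subsetD[OF r(2)])
      then have "norm (f n (z + y)) \<le> k" "norm (f n z) \<le> k"
        unfolding A_def by auto
      then have "norm (f n y) \<le> 2 * real k"
        using norm_triangle_ineq4[of "f n (z + y)" "f n z"] by (simp add: blinfun.add_right)
      then show ?thesis
        using False r by (simp add: y_def blinfun.scaleR_right field_simps)
    qed (simp add: blinfun.zero_right)
  qed (use r in simp)
  then show thesis by (rule that)
qed

lemma weak_star_null_bounded:
  fixes f :: "nat \<Rightarrow> 'a::banach \<Rightarrow>\<^sub>L real"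
  assumes "weak_star_null f"
  obtains C where "\<And>n. norm (f n) \<le> C"
proof -
  have "Bseq (\<lambda>n. f n x)" for x
    using assms unfolding weak_star_null_def by (blast intro: convergentI convergent_imp_Bseq)
  then show thesis using uniform_boundedness that by blast
qed

section \<open>Functionals on a lattice with order continuous norm\<close>

text \<open>
  The supremum of \<open>b\<^sub>n, \<dots>, b\<^bsub>n+k\<^esub>\<close>. Splitting off the first element rather than the last makes
  \<open>block_sup b (Suc n) k \<le> block_sup b n (Suc k)\<close> immediate.
\<close>

fun block_sup :: "(nat \<Rightarrow> 'a::lattice) \<Rightarrow> nat \<Rightarrow> nat \<Rightarrow> 'a" where
  "block_sup b n 0 = b n"
| "block_sup b n (Suc k) = sup (b n) (block_sup b (Suc n) k)"

lemma block_sup_le: "(\<And>m. b m \<le> w) \<Longrightarrow> block_sup b n k \<le> w"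
  by (induction b n k rule: block_sup.induct) auto

lemma block_sup_ge: "b n \<le> block_sup b n k"
  by (cases k) auto

lemma block_sup_Suc: "block_sup b n k \<le> block_sup b n (Suc k)"
proof (induction b n k rule: block_sup.induct)
  case (2 b n k)
  then show ?case by (auto intro: le_supI2 simp del: sup.bounded_iff intro!: sup_mono)
qed auto

lemma block_sup_le_sum:
  fixes b :: "nat \<Rightarrow> 'a::banach_lattice"
  assumes "\<And>m. 0 \<le> b m"
  shows "block_sup b n k \<le> (\<Sum>m=n..n+k. b m)"
  using assms
proof (induction b n k rule: block_sup.induct)
  case (1 b n)
  then show ?case by simp
next
  case (2 b n k)
  have s: "(\<Sum>m=n..n + Suc k. b m) = b n + (\<Sum>m=Suc n..Suc n + k. b m)"
    by (simp add: sum.atLeast_Suc_atMost)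
  have nn: "0 \<le> (\<Sum>m=Suc n..Suc n + k. b m)" by (intro sum_nonneg 2)
  have "block_sup b (Suc n) k \<le> (\<Sum>m=Suc n..Suc n + k. b m)"
    using 2 by blast
  also have "\<dots> \<le> b n + (\<Sum>m=Suc n..Suc n + k. b m)"
    using "2.prems"[of n] by simp
  finally show ?case
    unfolding s using nn by simp
qed

text \<open>
  Let \<open>s\<^sub>n\<close> be the supremum of all \<open>b\<^sub>m\<close> with \<open>m \<ge> n\<close>, which exists as a norm limit of finite
  suprema. The sequence \<open>s\<^sub>n\<close> decreases to a norm limit \<open>l\<close>. Each \<open>f\<^sub>i\<close> is at most a geometric tail at
  \<open>s\<^sub>n\<close> once \<open>n > i\<close>, hence nonpositive at \<open>l\<close>, and therefore \<open>f\<^sub>n b\<^sub>n \<le> f\<^sub>n (s\<^sub>n - l)\<close>, where \<open>s\<^sub>n - l\<close> tends to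
  \<open>0\<close> in norm and the \<open>f\<^sub>n\<close> are bounded.
\<close>

lemma almost_biorthogonal_null:
  fixes b :: "nat \<Rightarrow> 'a::banach_lattice" and f :: "nat \<Rightarrow> 'a \<Rightarrow>\<^sub>L real"
  assumes oc: "order_continuous_norm TYPE('a)"
    and b: "\<And>n. 0 \<le> b n" "\<And>n. b n \<le> w"
    and f: "\<And>n. 0 \<le> f n" "\<And>n. norm (f n) \<le> C"
    and small: "\<And>i n. i < n \<Longrightarrow> f i (b n) \<le> K * (1/2) ^ n"
  shows "(\<lambda>n. f n (b n)) \<longlonglongrightarrow> 0"
proof -
  have "convergent (block_sup b n)" for n
    by (rule order_continuous_norm_incseq_convergent[OF oc])
      (use block_sup_Suc lift_Suc_mono_le[of "block_sup b n"] in blast, use b block_sup_le in blast)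
  then obtain s where s: "\<And>n. block_sup b n \<longlonglongrightarrow> s n"
    unfolding convergent_def by metis
  have b_le_s: "b n \<le> s n" for n
    by (rule tendsto_le_lattice[OF tendsto_const s]) (rule block_sup_ge)
  have s_Suc: "s (Suc n) \<le> s n" for n
    by (rule tendsto_le_lattice[OF s LIMSEQ_Suc[OF s]]) simp
  have "convergent (\<lambda>n. - s n)"
  proof (rule order_continuous_norm_incseq_convergent[OF oc])
    show "- s m \<le> - s n" if "m \<le> n" for m n
      using lift_Suc_antimono_le[of s, OF s_Suc that] by simp
    show "- s n \<le> 0" for n
      using b(1)[of n] b_le_s[of n] by (simp add: order_trans)
  qed
  then obtain l where l: "s \<longlonglongrightarrow> l"
    unfolding convergent_def using tendsto_minus_cancel_left[of s] by metis
  have fs: "f i (s n) \<le> \<bar>K\<bar> * (2 * (1/2) ^ n)" if "i < n" for i n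
  proof (rule LIMSEQ_le_const2)
    show "(\<lambda>k. f i (block_sup b n k)) \<longlonglongrightarrow> f i (s n)"
      by (intro tendsto_intros s)
    have "f i (block_sup b n k) \<le> \<bar>K\<bar> * (2 * (1/2) ^ n)" for k
    proof -
      have "f i (block_sup b n k) \<le> f i (\<Sum>m=n..n+k. b m)"
        by (intro blinfun_mono f block_sup_le_sum b)
      also have "\<dots> = (\<Sum>m=n..n+k. f i (b m))"
        by (simp add: blinfun.sum_right)
      also have "\<dots> \<le> (\<Sum>m=n..n+k. \<bar>K\<bar> * (1/2) ^ m)"
      proof (rule sum_mono)
        fix m assume "m \<in> {n..n+k}"
        then have "f i (b m) \<le> K * (1/2) ^ m" using that by (intro small) auto
        also have "\<dots> \<le> \<bar>K\<bar> * (1/2) ^ m" by (intro mult_right_mono) auto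
        finally show "f i (b m) \<le> \<bar>K\<bar> * (1/2) ^ m" .
      qed
      also have "\<dots> = \<bar>K\<bar> * (2 * (1/2) ^ n - (1/2) ^ (n+k))"
        by (induction k) (auto simp: algebra_simps)
      also have "\<dots> \<le> \<bar>K\<bar> * (2 * (1/2) ^ n)"
        by (intro mult_left_mono) auto
      finally show ?thesis .
    qed
    then show "\<exists>N. \<forall>k\<ge>N. f i (block_sup b n k) \<le> \<bar>K\<bar> * (2 * (1/2) ^ n)" by blast
  qed
  have fl: "f i l \<le> 0" for i
  proof (rule LIMSEQ_le)
    show "(\<lambda>n. f i (s n)) \<longlonglongrightarrow> f i l" by (intro tendsto_intros l)
    have "(\<lambda>n. \<bar>K\<bar> * (2 * (1/2) ^ n)) \<longlonglongrightarrow> \<bar>K\<bar> * (2 * 0)"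
      by (intro tendsto_intros LIMSEQ_power_zero) auto
    then show "(\<lambda>n. \<bar>K\<bar> * (2 * (1/2) ^ n)) \<longlonglongrightarrow> 0" by simp
    show "\<exists>N. \<forall>n\<ge>N. f i (s n) \<le> \<bar>K\<bar> * (2 * (1/2) ^ n)"
      using fs by (meson Suc_le_lessD)
  qed
  show ?thesis
  proof (rule tendsto_sandwich)
    show "\<forall>\<^sub>F n in sequentially. 0 \<le> f n (b n)"
      by (simp add: blinfun_nonneg f b)
    have "f n (b n) \<le> C * norm (s n - l)" for n
    proof -
      have "f n (b n) \<le> f n (s n)" by (intro blinfun_mono f b_le_s)
      also have "\<dots> \<le> f n (s n) - f n l" using fl[of n] by simp
      also have "\<dots> = f n (s n - l)" by (simp add: blinfun.diff_right)
      also have "\<dots> \<le> norm (f n) * norm (s n - l)"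
        using abs_blinfun_apply_le[of "f n" "s n - l"] by simp
      also have "\<dots> \<le> C * norm (s n - l)" by (intro mult_right_mono f) simp
      finally show ?thesis .
    qed
    then show "\<forall>\<^sub>F n in sequentially. f n (b n) \<le> C * norm (s n - l)" by simp
    have "(\<lambda>n. C * norm (s n - l)) \<longlonglongrightarrow> C * norm (l - l)" by (intro tendsto_intros l)
    then show "(\<lambda>n. C * norm (s n - l)) \<longlonglongrightarrow> 0" by simp
  qed simp
qed

text \<open>
  Since \<open>\<bar>f\<^sub>n\<bar>\<close> is disjoint from the sum of the preceding moduli, there is a piece \<open>a\<^sub>n\<close> of \<open>x\<close> that
  carries almost all of \<open>\<bar>f\<^sub>n\<bar> x\<close> and on which the preceding moduli almost vanish. Such pieces
  stay below \<open>x\<close>, so \<open>almost_biorthogonal_null\<close> applies to them.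
\<close>

lemma bounded_disjoint_functionals_null:
  fixes f :: "nat \<Rightarrow> 'a::banach_lattice \<Rightarrow>\<^sub>L real"
  assumes oc: "order_continuous_norm TYPE('a)"
    and disj: "disjoint_seq f" and bdd: "\<And>n. norm (f n) \<le> C" and x: "0 \<le> x"
  shows "(\<lambda>n. \<bar>f n\<bar> x) \<longlonglongrightarrow> 0"
proof -
  have "\<exists>a\<ge>0. a \<le> x \<and> \<bar>f n\<bar> (x - a) + (\<Sum>i<n. \<bar>f i\<bar>) a < (1/2) ^ n" for n
  proof (rule dual_disjoint_split[OF _ x])
    have "inf (\<Sum>i<n. \<bar>f i\<bar>) \<bar>f n\<bar> = 0"
      using disj unfolding disjoint_seq_def by (intro inf_sum_eq_0) auto
    then show "inf \<bar>f n\<bar> (\<Sum>i<n. \<bar>f i\<bar>) = 0" by (simp add: inf.commute)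
  qed simp
  then obtain a where a: "\<And>n. 0 \<le> a n" "\<And>n. a n \<le> x"
    and split: "\<And>n. \<bar>f n\<bar> (x - a n) + (\<Sum>i<n. \<bar>f i\<bar>) (a n) < (1/2) ^ n"
    by metis
  have nn: "0 \<le> \<bar>f n\<bar> (x - a n)" for n
    using a by (intro blinfun_nonneg) auto
  have nn2: "0 \<le> (\<Sum>i<n. \<bar>f i\<bar>) (a n)" for n
    using a by (intro blinfun_nonneg sum_nonneg) auto
  have "(\<lambda>n. \<bar>f n\<bar> (a n)) \<longlonglongrightarrow> 0"
  proof (rule almost_biorthogonal_null[OF oc a])
    show "\<bar>f i\<bar> (a n) \<le> 1 * (1/2) ^ n" if "i < n" for i n
    proof -
      have "\<bar>f i\<bar> (a n) \<le> (\<Sum>i<n. \<bar>f i\<bar> (a n))"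
        using that a by (intro member_le_sum) (auto intro: blinfun_nonneg)
      also have "\<dots> = (\<Sum>i<n. \<bar>f i\<bar>) (a n)" by (simp add: blinfun.sum_left)
      also have "\<dots> \<le> (1/2) ^ n" using split[of n] nn[of n] by simp
      finally show ?thesis by simp
    qed
    show "norm \<bar>f n\<bar> \<le> C" for n using bdd by simp
  qed simp
  moreover have "(\<lambda>n. \<bar>f n\<bar> (x - a n)) \<longlonglongrightarrow> 0"
  proof (rule tendsto_sandwich[OF _ _ tendsto_const LIMSEQ_power_zero])
    show "\<forall>\<^sub>F n in sequentially. \<bar>f n\<bar> (x - a n) \<le> (1/2) ^ n"
      using split nn2 by (intro always_eventually allI) (smt (verit))
  qed (use nn in auto)
  ultimately have "(\<lambda>n. \<bar>f n\<bar> (x - a n) + \<bar>f n\<bar> (a n)) \<longlonglongrightarrow> 0"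
    using tendsto_add_zero by blast
  then show ?thesis by (simp add: blinfun.diff_right)
qed

section \<open>Disjoint sequences in a lattice whose dual has order continuous norm\<close>

text \<open>
  The Kantorovich extension: additive and positively homogeneous functions on the cone extend
  to the whole space by taking differences.
\<close>

lemma positive_cone_extension:
  fixes p :: "'a::banach_lattice \<Rightarrow> real"
  assumes add: "\<And>x y. 0 \<le> x \<Longrightarrow> 0 \<le> y \<Longrightarrow> p (x + y) = p x + p y"
    and scale: "\<And>r x. 0 \<le> x \<Longrightarrow> 0 \<le> r \<Longrightarrow> p (r *\<^sub>R x) = r * p x"
    and bound: "\<And>x. 0 \<le> x \<Longrightarrow> \<bar>p x\<bar> \<le> C * norm x"
  obtains g :: "'a \<Rightarrow>\<^sub>L real" where "\<And>x. 0 \<le> x \<Longrightarrow> g x = p x"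
proof -
  define P where "P x = p (pprt x) - p (- nprt x)" for x
  have p0: "p 0 = 0" using scale[of 0 0] by simp
  have P: "P (a - b) = p a - p b" if "0 \<le> a" "0 \<le> b" for a b
  proof -
    have "a + (- nprt (a - b)) = pprt (a - b) + b"
      using prts[of "a - b"] by (simp add: algebra_simps)
    then have "p a + p (- nprt (a - b)) = p (pprt (a - b)) + p b"
      using that by (metis add neg_0_le_iff_le nprt_le_zero zero_le_pprt)
    then show ?thesis unfolding P_def by simp
  qed
  have "bounded_linear P"
  proof (rule bounded_linear_intro)
    fix x y :: 'a
    have "x + y = (pprt x + pprt y) - (- nprt x + - nprt y)"
      using prts[of x] prts[of y] by (metis add_diff_add pprt_minus_neg_nprt)
    then have "P (x + y) = p (pprt x + pprt y) - p (- nprt x + - nprt y)"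
      by (simp only:) (rule P; intro add_nonneg_nonneg; simp)
    also have "\<dots> = P x + P y"
      unfolding P_def by (subst (1 2) add) simp_all
    finally show "P (x + y) = P x + P y" .
  next
    fix r :: real and x :: 'a
    show "P (r *\<^sub>R x) = r *\<^sub>R P x"
    proof (cases "0 \<le> r")
      case True
      have "r *\<^sub>R x = r *\<^sub>R pprt x - r *\<^sub>R (- nprt x)"
        by (metis pprt_minus_neg_nprt scaleR_diff_right)
      then have "P (r *\<^sub>R x) = p (r *\<^sub>R pprt x) - p (r *\<^sub>R (- nprt x))"
        using True by (simp only:) (rule P; intro scaleR_nonneg_nonneg; simp)
      then show ?thesis
        using True unfolding P_def
        by (simp only: scale neg_0_le_iff_le nprt_le_zero zero_le_pprt) (simp add: algebra_simps)
    next
      case False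
      then have r: "0 \<le> - r" by simp
      have "r *\<^sub>R x = (- r) *\<^sub>R (- nprt x) - (- r) *\<^sub>R pprt x"
        using pprt_minus_neg_nprt[of x]
        by (metis minus_diff_eq scaleR_diff_right scaleR_minus_left scaleR_minus_right)
      then have "P (r *\<^sub>R x) = p ((- r) *\<^sub>R (- nprt x)) - p ((- r) *\<^sub>R pprt x)"
        using r by (simp only:) (rule P; intro scaleR_nonneg_nonneg; simp)
      then show ?thesis
        using r unfolding P_def
        by (simp only: scale neg_0_le_iff_le nprt_le_zero zero_le_pprt) (simp add: algebra_simps)
    qed
  next
    fix x :: 'a
    have "norm (P x) \<le> \<bar>p (pprt x)\<bar> + \<bar>p (- nprt x)\<bar>"
      unfolding P_def by simp
    also have "\<dots> \<le> C * norm (pprt x) + C * norm (- nprt x)"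
      by (intro add_mono bound) simp_all
    also have "\<dots> \<le> \<bar>C\<bar> * norm x + \<bar>C\<bar> * norm x"
      unfolding norm_minus_cancel
      by (intro add_mono mult_mono norm_pprt_le norm_nprt_le) auto
    finally show "norm (P x) \<le> norm x * (2 * \<bar>C\<bar>)"
      by (simp add: algebra_simps)
  qed
  then have "Blinfun P x = p x" if "0 \<le> x" for x
    using that by (simp add: bounded_linear_Blinfun_apply P_def p0)
  then show thesis by (rule that)
qed

text \<open>
  The component of \<open>f\<close> carried by \<open>u\<close>: its value at \<open>x \<ge> 0\<close> is the supremum of \<open>f\<close> over those
  elements between \<open>0\<close> and \<open>x\<close> that lie in the ideal generated by \<open>u\<close>. Additivity comes from
  the Riesz decomposition property, as for the positive part of a functional.
\<close>

lemma functional_restriction_to_band: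
  fixes f :: "'a::banach_lattice \<Rightarrow>\<^sub>L real"
  assumes f: "0 \<le> f" and u: "0 \<le> u"
  obtains g where "0 \<le> g" "g \<le> f" "g u = f u" "\<And>v. 0 \<le> v \<Longrightarrow> inf v u = 0 \<Longrightarrow> g v = 0"
proof -
  define A where "A x = {y. 0 \<le> y \<and> y \<le> x \<and> (\<exists>k\<ge>0. y \<le> k *\<^sub>R u)}" for x
  define p where "p x = (SUP y\<in>A x. f y)" for x
  have bdd: "bdd_above (f ` A x)" for x
    using f by (intro bdd_aboveI2[of _ _ "f x"]) (auto simp: A_def intro: blinfun_mono)
  have zero: "0 \<in> A x" if "0 \<le> x" for x
    using that u unfolding A_def by (auto intro!: exI[of _ 0])
  have upper: "f y \<le> p x" if "y \<in> A x" for x y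
    unfolding p_def by (intro cSUP_upper that bdd)
  have least: "p x \<le> c" if "0 \<le> x" "\<And>y. y \<in> A x \<Longrightarrow> f y \<le> c" for x c
    unfolding p_def using zero[OF that(1)] that(2) by (intro cSUP_least) auto
  have p_nonneg: "0 \<le> p x" if "0 \<le> x" for x
    using upper[OF zero[OF that]] by (simp add: blinfun.zero_right)
  have p_le: "p x \<le> f x" if "0 \<le> x" for x
    using that f by (intro least) (auto simp: A_def intro: blinfun_mono)
  have p_add: "p (x + y) = p x + p y" if xy: "0 \<le> x" "0 \<le> y" for x y
  proof (rule antisym)
    show "p (x + y) \<le> p x + p y"
    proof (rule least)
      fix z assume "z \<in> A (x + y)"
      then obtain k where z: "0 \<le> z" "z \<le> x + y" "0 \<le> k" "z \<le> k *\<^sub>R u"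
        unfolding A_def by auto
      have "z - y \<le> inf z x"
        using z xy by (simp add: diff_le_eq add.commute)
      then have le: "z - inf z x \<le> y"
        by (simp only: diff_le_eq) (simp add: add.commute)
      have nonneg: "0 \<le> z - inf z x"
        by (simp only: diff_ge_0_iff_ge inf_le1)
      have "0 \<le> inf z x" using z xy by simp
      then have "z - inf z x \<le> z" by (simp only: diff_le_eq le_add_same_cancel1)
      then have "z - inf z x \<le> k *\<^sub>R u" using z(4) by (rule order_trans)
      then have "z - inf z x \<in> A y"
        unfolding A_def using z(3) le nonneg by blast
      moreover have "inf z x \<in> A x"
        unfolding A_def using z xy by (auto intro!: exI[of _ k] intro: le_infI1)
      ultimately have "z - inf z x \<in> A y" "inf z x \<in> A x" by simp_all
      from upper[OF this(1)] upper[OF this(2)] show "f z \<le> p x + p y"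
        unfolding blinfun.diff_right by linarith
    qed (use xy in simp)
    have "p x \<le> p (x + y) - f b" if b: "b \<in> A y" for b
    proof (rule least[OF xy(1)])
      fix a assume a: "a \<in> A x"
      obtain k l where kl: "0 \<le> k" "0 \<le> l" "a \<le> k *\<^sub>R u" "b \<le> l *\<^sub>R u"
        using a b unfolding A_def by auto
      have "a + b \<le> (k + l) *\<^sub>R u"
        using add_mono[OF kl(3,4)] by (simp add: scaleR_add_left)
      then have "a + b \<in> A (x + y)"
        using a b kl unfolding A_def by (auto intro!: add_mono exI[of _ "k + l"])
      from upper[OF this] show "f a \<le> p (x + y) - f b"
        by (simp add: blinfun.add_right)
    qed
    then have "p y \<le> p (x + y) - p x"
      by (intro least xy) (simp add: algebra_simps)
    then show "p x + p y \<le> p (x + y)" by simp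
  qed
  have scale_le: "p (r *\<^sub>R x) \<le> r * p x" if x: "0 \<le> x" and r: "0 < r" for r x
  proof (rule least)
    fix z assume "z \<in> A (r *\<^sub>R x)"
    then obtain k where z: "0 \<le> z" "z \<le> r *\<^sub>R x" "0 \<le> k" "z \<le> k *\<^sub>R u"
      unfolding A_def by auto
    have "inverse r *\<^sub>R z \<le> inverse r *\<^sub>R (r *\<^sub>R x)" "inverse r *\<^sub>R z \<le> inverse r *\<^sub>R (k *\<^sub>R u)"
      using z r by (intro scaleR_left_mono; simp)+
    then have "inverse r *\<^sub>R z \<in> A x"
      using z r unfolding A_def by (auto intro!: exI[of _ "k / r"] scaleR_nonneg_nonneg simp: field_simps)
    from upper[OF this] show "f z \<le> r * p x"
      using r by (simp add: blinfun.scaleR_right field_simps)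
  qed (use x r in \<open>auto intro: scaleR_nonneg_nonneg\<close>)
  have p_scale: "p (r *\<^sub>R x) = r * p x" if x: "0 \<le> x" and r: "0 \<le> r" for r x
  proof (cases "r = 0")
    case True
    then show ?thesis using p_nonneg[of 0] p_le[of 0] by (simp add: blinfun.zero_right)
  next
    case False
    then have r: "0 < r" using r by simp
    have "p (inverse r *\<^sub>R (r *\<^sub>R x)) \<le> inverse r * p (r *\<^sub>R x)"
      using x r by (intro scale_le scaleR_nonneg_nonneg) auto
    then have "r * p x \<le> p (r *\<^sub>R x)" using r by (simp add: field_simps)
    then show ?thesis using scale_le[OF x r] by simp
  qed
  have "\<bar>p x\<bar> \<le> norm f * norm x" if "0 \<le> x" for x
    using p_nonneg[OF that] p_le[OF that] abs_blinfun_apply_le[of f x] by simp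
  then obtain g :: "'a \<Rightarrow>\<^sub>L real" where g: "\<And>x. 0 \<le> x \<Longrightarrow> g x = p x"
    using positive_cone_extension[of p "norm f"] p_add p_scale by metis
  show thesis
  proof
    show "0 \<le> g" by (simp add: less_eq_blinfun_def g p_nonneg)
    show "g \<le> f" by (simp add: less_eq_blinfun_def g p_le)
    have "u \<in> A u" unfolding A_def using u by (auto intro!: exI[of _ 1])
    then show "g u = f u"
      using upper[of u u] p_le[OF u] g[OF u] by simp
    fix v assume v: "0 \<le> v" "inf v u = 0"
    \<comment> \<open>an element of the ideal of \<open>u\<close> below \<open>v\<close> is, after scaling by \<open>1/l\<close> with
      \<open>l \<ge> 1\<close>, below both \<open>u\<close> and \<open>v\<close>, hence \<open>0\<close>\<close>
    have "p v \<le> 0"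
    proof (rule least[OF v(1)])
      fix y assume "y \<in> A v"
      then obtain k where y: "0 \<le> y" "y \<le> v" "0 \<le> k" "y \<le> k *\<^sub>R u"
        unfolding A_def by auto
      define l where "l = max 1 k"
      have l: "1 \<le> l" "k \<le> l" unfolding l_def by auto
      have "inverse l *\<^sub>R y \<le> inverse l *\<^sub>R (l *\<^sub>R u)"
        using y l u by (intro scaleR_left_mono order_trans[OF y(4)] scaleR_right_mono) auto
      then have "inverse l *\<^sub>R y \<le> u" using l by simp
      moreover have "inverse l *\<^sub>R y \<le> 1 *\<^sub>R y"
        using y l by (intro scaleR_right_mono) (auto simp: field_simps)
      then have "inverse l *\<^sub>R y \<le> v" using y by simp
      ultimately have "inverse l *\<^sub>R y \<le> inf v u" by simp
      then have "inverse l *\<^sub>R y \<le> 0" using v by simp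
      then have "l *\<^sub>R (inverse l *\<^sub>R y) \<le> l *\<^sub>R 0" using l by (intro scaleR_left_mono) auto
      then have "y \<le> 0" using l by simp
      then have "y = 0" using y by (simp add: antisym)
      then show "f y \<le> 0" by (simp add: blinfun.zero_right)
    qed
    then show "g v = 0" using g p_nonneg v by (simp add: antisym)
  qed
qed

definition bidual_eval :: "'a::real_normed_vector \<Rightarrow> ('a \<Rightarrow>\<^sub>L real) \<Rightarrow>\<^sub>L real" where
  "bidual_eval x = Blinfun (\<lambda>f. blinfun_apply f x)"

lemma bidual_eval_apply: "bidual_eval x f = f x"
  unfolding bidual_eval_def
  by (simp add: bounded_linear_Blinfun_apply blinfun.bounded_linear_left)

lemma norm_bidual_eval_le: "norm (bidual_eval x) \<le> norm x"
proof (rule norm_blinfun_bound)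
  fix f :: "'a \<Rightarrow>\<^sub>L real"
  show "norm (bidual_eval x f) \<le> norm x * norm f"
    using norm_blinfun[of f x] by (simp add: bidual_eval_apply mult.commute)
qed simp

lemma bidual_eval_nonneg:
  fixes x :: "'a::banach_lattice"
  shows "0 \<le> x \<Longrightarrow> 0 \<le> bidual_eval x"
  by (simp add: less_eq_blinfun_def bidual_eval_apply blinfun_nonneg)

text \<open>
  A positive functional \<open>f\<close> on \<open>E\<close> splits into the component \<open>g\<close> carried by \<open>x\<close>, which vanishes at \<open>y\<close>,
  and \<open>f - g\<close>, which vanishes at \<open>x\<close>. A common lower bound of the two evaluations is nonpositive
  on both summands.
\<close>

lemma bidual_eval_disjoint:
  fixes x y :: "'a::banach_lattice"
  assumes xy: "0 \<le> x" "0 \<le> y" "inf x y = 0"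
  shows "inf (bidual_eval x) (bidual_eval y) = 0"
proof (rule antisym)
  let ?m = "inf (bidual_eval x) (bidual_eval y)"
  show "?m \<le> 0"
    unfolding less_eq_blinfun_def[of ?m]
  proof (intro allI impI)
    fix f :: "'a \<Rightarrow>\<^sub>L real" assume f: "0 \<le> f"
    obtain g where g: "0 \<le> g" "g \<le> f" "g x = f x" "\<And>v. 0 \<le> v \<Longrightarrow> inf v x = 0 \<Longrightarrow> g v = 0"
      using functional_restriction_to_band[OF f xy(1)] by blast
    have "?m g \<le> bidual_eval y g" "?m (f - g) \<le> bidual_eval x (f - g)"
      using g inf_le1[of "bidual_eval x" "bidual_eval y"] inf_le2[of "bidual_eval x" "bidual_eval y"]
      unfolding less_eq_blinfun_def[where 'a="'a \<Rightarrow>\<^sub>L real"] by (metis diff_ge_0_iff_ge)+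
    moreover have "g y = 0" using xy by (intro g) (auto simp: inf.commute)
    ultimately have "?m g \<le> 0" "?m (f - g) \<le> 0"
      using g by (simp_all add: bidual_eval_apply blinfun.diff_left)
    then show "?m f \<le> (0 :: ('a \<Rightarrow>\<^sub>L real) \<Rightarrow>\<^sub>L real) f"
      by (simp add: blinfun.diff_right)
  qed
  show "0 \<le> ?m" using xy by (simp add: bidual_eval_nonneg)
qed

lemma bounded_disjoint_weakly_null:
  fixes x :: "nat \<Rightarrow> 'a::banach_lattice"
  assumes oc: "order_continuous_norm TYPE('a \<Rightarrow>\<^sub>L real)"
    and x: "disjoint_seq x" "\<And>n. 0 \<le> x n" "\<And>n. norm (x n) \<le> C"
  shows "weakly_null x"
  unfolding weakly_null_def
proof
  fix f :: "'a \<Rightarrow>\<^sub>L real"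
  have J: "0 \<le> bidual_eval (x n)" for n using x by (simp add: bidual_eval_nonneg)
  have "(\<lambda>n. \<bar>bidual_eval (x n)\<bar> \<bar>f\<bar>) \<longlonglongrightarrow> 0"
  proof (rule bounded_disjoint_functionals_null[OF oc])
    show "disjoint_seq (\<lambda>n. bidual_eval (x n))"
      using x(1,2) J unfolding disjoint_seq_def by (auto intro!: bidual_eval_disjoint)
    show "norm (bidual_eval (x n)) \<le> C" for n
      using norm_bidual_eval_le x(3) order_trans by blast
  qed simp
  then have "(\<lambda>n. \<bar>f\<bar> (x n)) \<longlonglongrightarrow> 0"
    using J by (simp add: bidual_eval_apply)
  moreover have "norm (f (x n)) \<le> \<bar>f\<bar> (x n)" for n
    using blinfun_le_abs[of f "x n"] blinfun_le_abs[of "- f" "x n"] x(2)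
    by (simp add: blinfun.minus_left abs_le_iff)
  ultimately show "(\<lambda>n. f (x n)) \<longlonglongrightarrow> 0"
    by (intro Lim_null_comparison[of "\<lambda>n. f (x n)" "\<lambda>n. \<bar>f\<bar> (x n)"]) auto
qed

lemma weakly_null_imp_weak_star_null:
  fixes f :: "nat \<Rightarrow> 'a::real_normed_vector \<Rightarrow>\<^sub>L real"
  assumes "weakly_null f"
  shows "weak_star_null f"
  unfolding weak_star_null_def
proof
  fix x
  have "(\<lambda>n. bidual_eval x (f n)) \<longlonglongrightarrow> 0"
    using assms unfolding weakly_null_def by blast
  then show "(\<lambda>n. f n x) \<longlonglongrightarrow> 0" by (simp add: bidual_eval_apply)
qed

lemma almost_Dunford_Pettis_disjoint_null:
  fixes T :: "'a::banach_lattice \<Rightarrow> 'b::banach_lattice"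
  assumes oc: "order_continuous_norm TYPE('a \<Rightarrow>\<^sub>L real)" and T: "almost_Dunford_Pettis T"
    and y: "disjoint_seq y" "\<And>n. 0 \<le> y n" "\<And>n. norm (y n) \<le> C"
  shows "(\<lambda>n. T (y n)) \<longlonglongrightarrow> 0"
  using T bounded_disjoint_weakly_null[OF oc y] y(1)
  unfolding almost_Dunford_Pettis_def norm_null_def by blast

section \<open>Approximate order boundedness of an operator and its adjoint\<close>

text \<open>
  Recursive choice in which each term depends on the previous ones only through a sum; the
  recursion runs over the partial sums.
\<close>

lemma sequence_from_partial_sums:
  fixes F :: "nat \<Rightarrow> 's::comm_monoid_add \<Rightarrow> 'x" and h :: "'x \<Rightarrow> 's"
  obtains x where "\<And>n. x n = F n (\<Sum>i<n. h (x i))"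
proof -
  define S where "S = rec_nat 0 (\<lambda>n s. s + h (F n s))"
  have "S n = (\<Sum>i<n. h (F i (S i)))" for n
    by (induction n) (simp_all add: S_def)
  then have "F n (S n) = F n (\<Sum>i<n. h (F i (S i)))" for n
    by (rule arg_cong)
  then show thesis by (rule that)
qed

text \<open>
  If no \<open>u\<close> works, choose \<open>x\<^sub>n\<close> in the unit ball for \<open>u = 4\<^sup>n (x\<^sub>0 + \<dots> + x\<^bsub>n-1\<^esub>)\<close>. The part of
  \<open>x\<^sub>n\<close> above this \<open>u\<close> changes little in norm when a small multiple of \<open>s = \<Sum>i. 2\<^sup>-\<^sup>i x\<^sub>i\<close> is also
  subtracted, and after this correction the parts are pairwise disjoint by
  \<open>inf_pprt_diff_scaled\<close>. Their images would have to tend to \<open>0\<close>.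
\<close>

lemma M_weakly_compact_truncation:
  fixes T :: "'a::banach_lattice \<Rightarrow> 'b::banach_lattice"
  assumes T: "positive_operator T"
    and null: "\<And>y. disjoint_seq y \<Longrightarrow> (\<And>n. 0 \<le> y n) \<Longrightarrow> (\<And>n. norm (y n) \<le> 1)
      \<Longrightarrow> (\<lambda>n. T (y n)) \<longlonglongrightarrow> 0"
    and e: "0 < e"
  shows "\<exists>u\<ge>0. \<forall>x\<ge>0. norm x \<le> 1 \<longrightarrow> norm (T (pprt (x - u))) \<le> e"
proof (rule ccontr)
  assume "\<not> ?thesis"
  then have "\<forall>u\<ge>0. \<exists>x\<ge>0. norm x \<le> 1 \<and> e < norm (T (pprt (x - u)))"
    by (simp add: not_le)
  then obtain X where X: "\<And>u. 0 \<le> u \<Longrightarrow> 0 \<le> X u" "\<And>u. 0 \<le> u \<Longrightarrow> norm (X u) \<le> 1"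
    "\<And>u. 0 \<le> u \<Longrightarrow> e < norm (T (pprt (X u - u)))"
    by metis
  obtain x where x: "\<And>n. x n = X (4 ^ n *\<^sub>R (\<Sum>i<n. x i))"
    using sequence_from_partial_sums[of "\<lambda>n s. X (4 ^ n *\<^sub>R s)" "\<lambda>x. x"] by blast
  define S where "S n = (\<Sum>i<n. x i)" for n
  have x_nonneg: "0 \<le> x n" for n
  proof (induction n rule: less_induct)
    case (less n)
    then show ?case
      by (subst x) (auto intro!: X scaleR_nonneg_nonneg sum_nonneg)
  qed
  have S_nonneg: "0 \<le> S n" for n
    unfolding S_def by (intro sum_nonneg x_nonneg)
  have xS: "x n = X (4 ^ n *\<^sub>R S n)" for n
    unfolding S_def by (rule x)
  have xn: "norm (x n) \<le> 1" "e < norm (T (pprt (x n - 4 ^ n *\<^sub>R S n)))" for n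
    using X(2,3)[of "4 ^ n *\<^sub>R S n"] S_nonneg[of n] by (simp_all add: xS scaleR_nonneg_nonneg)
  define s where "s = (\<Sum>i. (1/2) ^ i *\<^sub>R x i)"
  have "summable (\<lambda>i. (1/2) ^ i *\<^sub>R x i)"
  proof (rule summable_comparison_test')
    show "summable (\<lambda>i. (1/2::real) ^ i)" by (simp add: summable_geometric)
    show "norm ((1/2) ^ i *\<^sub>R x i) \<le> (1/2) ^ i" for i
      using xn(1)[of i] by (simp add: mult_left_le)
  qed
  then have x_le_s: "(1/2) ^ i *\<^sub>R x i \<le> s" for i
    unfolding s_def by (rule le_suminf) (simp add: scaleR_nonneg_nonneg x_nonneg)
  have s_nonneg: "0 \<le> s"
    using x_le_s[of 0] x_nonneg[of 0] by simp
  define y where "y n = pprt (x n - 4 ^ n *\<^sub>R S n - (1/2) ^ n *\<^sub>R s)" for n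
  have y_nonneg: "0 \<le> y n" for n by (simp add: y_def)
  have S4: "0 \<le> 4 ^ n *\<^sub>R S n" and s2: "0 \<le> (1/2::real) ^ n *\<^sub>R s" for n
    using S_nonneg s_nonneg by (simp_all add: scaleR_nonneg_nonneg)
  have y_le: "y n \<le> x n" for n
  proof -
    have "x n - (4 ^ n *\<^sub>R S n + (1/2) ^ n *\<^sub>R s) \<le> x n - 0"
      by (intro diff_left_mono add_nonneg_nonneg S4 s2)
    then have "y n \<le> pprt (x n)"
      unfolding y_def diff_diff_eq by (intro pprt_mono) simp
    then show ?thesis using x_nonneg by simp
  qed
  \<comment> \<open>for \<open>m < n\<close>, \<open>y\<^sub>n\<close> has lost \<open>4\<^sup>n x\<^sub>m\<close>, and \<open>y\<^sub>m\<close> has lost \<open>2\<^bsup>-m-n\<^esup> x\<^sub>n \<ge> 4\<^bsup>-n\<^esup> x\<^sub>n\<close>\<close>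
  have disj: "inf (y n) (y m) = 0" if "m < n" for m n
  proof (rule antisym)
    have "x m \<le> S n"
      unfolding S_def using that x_nonneg sum_mono2[of "{..<n}" "{m}" x] by simp
    then have "4 ^ n *\<^sub>R x m \<le> 4 ^ n *\<^sub>R S n" by (intro scaleR_left_mono) auto
    then have "4 ^ n *\<^sub>R x m \<le> 4 ^ n *\<^sub>R S n + (1/2) ^ n *\<^sub>R s"
      using s2 by (rule add_increasing2[rotated])
    then have 1: "y n \<le> pprt (x n - 4 ^ n *\<^sub>R x m)"
      unfolding y_def by (intro pprt_mono) (simp add: diff_diff_eq diff_left_mono)
    have "(1 / 4 ^ n :: real) = (1/2) ^ n * (1/2) ^ n"
      by (simp add: power_divide flip: power_mult_distrib)
    also have "\<dots> \<le> (1/2) ^ m * (1/2) ^ n"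
      using that by (intro mult_right_mono power_decreasing) auto
    finally have "(1 / 4 ^ n) *\<^sub>R x n \<le> ((1/2) ^ m * (1/2) ^ n) *\<^sub>R x n"
      by (rule scaleR_right_mono[OF _ x_nonneg])
    also have "\<dots> \<le> (1/2) ^ m *\<^sub>R s"
      unfolding scaleR_scaleR[symmetric] by (intro scaleR_left_mono x_le_s) auto
    finally have "(1 / 4 ^ n) *\<^sub>R x n \<le> 4 ^ m *\<^sub>R S m + (1/2) ^ m *\<^sub>R s"
      using S4 by (rule add_increasing[rotated])
    then have 2: "y m \<le> pprt (x m - (1 / 4 ^ n) *\<^sub>R x n)"
      unfolding y_def by (intro pprt_mono) (simp add: diff_diff_eq diff_left_mono)
    have "inf (y n) (y m) \<le> inf (pprt (x n - 4 ^ n *\<^sub>R x m)) (pprt (x m - (1 / 4 ^ n) *\<^sub>R x n))"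
      by (intro inf_mono 1 2)
    also have "\<dots> = 0" by (rule inf_pprt_diff_scaled) simp
    finally show "inf (y n) (y m) \<le> 0" .
  qed (simp add: y_nonneg)
  have "disjoint_seq y"
    unfolding disjoint_seq_def
  proof (intro allI impI)
    fix m n :: nat assume "m \<noteq> n"
    then show "inf \<bar>y m\<bar> \<bar>y n\<bar> = 0"
      using disj[of m n] disj[of n m] y_nonneg by (cases "m < n") (auto simp: inf.commute)
  qed
  moreover have "norm (y n) \<le> 1" for n
    using norm_mono_pos[OF y_nonneg y_le] xn(1) order_trans by blast
  ultimately have "(\<lambda>n. T (y n)) \<longlonglongrightarrow> 0"
    using y_nonneg by (intro null)
  then have "(\<lambda>n. norm (T (y n)) + (1/2) ^ n * norm (T s)) \<longlonglongrightarrow> norm (0::'b) + 0 * norm (T s)"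
    by (intro tendsto_intros LIMSEQ_power_zero) auto
  moreover have "e \<le> norm (T (y n)) + (1/2) ^ n * norm (T s)" for n
  proof -
    have lin: "linear T" using T by (simp add: positive_operator_def)
    have "x n - 4 ^ n *\<^sub>R S n - (1/2) ^ n *\<^sub>R s \<le> y n" by (simp add: y_def pprt_def)
    then have "pprt (x n - 4 ^ n *\<^sub>R S n) \<le> y n + (1/2) ^ n *\<^sub>R s"
      using y_nonneg s2 unfolding pprt_def by (simp add: diff_le_eq)
    then have "T (pprt (x n - 4 ^ n *\<^sub>R S n)) \<le> T (y n + (1/2) ^ n *\<^sub>R s)"
      by (rule positive_operator_mono[OF T])
    moreover have "0 \<le> T (pprt (x n - 4 ^ n *\<^sub>R S n))"
      using T by (simp add: positive_operator_def)
    ultimately have "norm (T (pprt (x n - 4 ^ n *\<^sub>R S n))) \<le> norm (T (y n + (1/2) ^ n *\<^sub>R s))"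
      by (intro norm_mono_pos)
    also have "\<dots> \<le> norm (T (y n)) + (1/2) ^ n * norm (T s)"
      using norm_triangle_ineq[of "T (y n)" "(1/2) ^ n *\<^sub>R T s"]
      by (simp add: linear_add[OF lin] linear_scale[OF lin])
    finally show ?thesis using xn(2)[of n] by simp
  qed
  ultimately have "e \<le> norm (0::'b) + 0 * norm (T s)"
    using LIMSEQ_le_const by blast
  then show False using e by simp
qed

lemma banach_adjoint_bounded_linear:
  fixes T :: "'a::real_normed_vector \<Rightarrow> 'b::real_normed_vector"
  assumes bl: "bounded_linear T"
  shows "bounded_linear (banach_adjoint T)"
proof (rule bounded_linear_intro)
  show "banach_adjoint T (f + g) = banach_adjoint T f + banach_adjoint T g" for f g
    by (rule blinfun_eqI) (simp add: banach_adjoint_apply[OF bl] blinfun.add_left)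
  show "banach_adjoint T (r *\<^sub>R f) = r *\<^sub>R banach_adjoint T f" for r f
    by (rule blinfun_eqI) (simp add: banach_adjoint_apply[OF bl] blinfun.scaleR_left)
  show "norm (banach_adjoint T f) \<le> norm f * onorm T" for f
  proof (rule norm_blinfun_bound)
    fix x
    have "norm (f (T x)) \<le> norm f * norm (T x)" by (rule norm_blinfun)
    also have "\<dots> \<le> norm f * (onorm T * norm x)"
      by (intro mult_left_mono onorm[OF bl]) simp
    finally show "norm (banach_adjoint T f x) \<le> norm f * onorm T * norm x"
      by (simp add: banach_adjoint_apply[OF bl] mult.assoc)
  qed (simp add: onorm_pos_le[OF bl])
qed

lemma banach_adjoint_mono:
  fixes T :: "'a::banach_lattice \<Rightarrow> 'b::banach_lattice"
  assumes T: "positive_operator T" and "f \<le> g"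
  shows "banach_adjoint T f \<le> banach_adjoint T g"
  using assms positive_operator_bounded_linear[OF T]
  by (simp add: less_eq_blinfun_def banach_adjoint_apply positive_operator_def)

text \<open>
  If no \<open>g\<close> works, choose \<open>f\<^sub>n\<close> for \<open>g = 2\<^sup>n (T\<^sup>*f\<^sub>0 + \<dots> + T\<^sup>*f\<^bsub>n-1\<^esub>)\<close>. The Riesz-Kantorovich
  formula gives \<open>a\<^sub>n \<ge> 0\<close> in the unit ball with \<open>(T\<^sup>*f\<^sub>n - g) a\<^sub>n > d\<close>. This one inequality says both
  that \<open>T\<^sup>*f\<^sub>n a\<^sub>n > d\<close> and that the earlier \<open>T\<^sup>*f\<^sub>i\<close> are at most \<open>2\<^sup>-\<^sup>n \<parallel>T\<parallel>\<close> at \<open>a\<^sub>n\<close>. Truncating \<open>a\<^sub>n\<close> at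
  a suitable \<open>u\<close> costs at most \<open>d/2\<close> and brings the images into an order interval, where
  \<open>almost_biorthogonal_null\<close> yields a contradiction.
\<close>

lemma positive_adjoint_L_weakly_compact:
  fixes T :: "'a::banach_lattice \<Rightarrow> 'b::banach_lattice"
  assumes oc: "order_continuous_norm TYPE('b)" and T: "positive_operator T"
    and trunc: "\<And>e. 0 < e \<Longrightarrow> \<exists>u\<ge>0. \<forall>x\<ge>0. norm x \<le> 1 \<longrightarrow> norm (T (pprt (x - u))) \<le> e"
    and d: "0 < d"
  shows "\<exists>g\<ge>0. \<forall>f\<ge>0. norm f \<le> 1 \<longrightarrow> norm (pprt (banach_adjoint T f - g)) \<le> d"
proof (rule ccontr)
  note bl = positive_operator_bounded_linear[OF T]
  assume "\<not> ?thesis"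
  then have "\<forall>g\<ge>0. \<exists>f\<ge>0. norm f \<le> 1 \<and> d < norm (pprt (banach_adjoint T f - g))"
    by (simp add: not_le)
  then obtain F where F: "\<And>g. 0 \<le> g \<Longrightarrow> 0 \<le> F g" "\<And>g. 0 \<le> g \<Longrightarrow> norm (F g) \<le> 1"
    "\<And>g. 0 \<le> g \<Longrightarrow> d < norm (pprt (banach_adjoint T (F g) - g))"
    by metis
  obtain f where f: "\<And>n. f n = F (2 ^ n *\<^sub>R (\<Sum>i<n. banach_adjoint T (f i)))"
    using sequence_from_partial_sums[of "\<lambda>n s. F (2 ^ n *\<^sub>R s)" "banach_adjoint T"] by blast
  define h where "h n = banach_adjoint T (f n)" for n
  have h_apply: "h n x = f n (T x)" for n x
    unfolding h_def by (rule banach_adjoint_apply[OF bl])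
  have h_nonneg: "0 \<le> h n" if "0 \<le> f n" for n
    using that T by (simp add: less_eq_blinfun_def h_apply positive_operator_def)
  have f_nonneg: "0 \<le> f n" for n
  proof (induction n rule: less_induct)
    case (less n)
    then show ?case
      by (subst f) (auto intro!: F scaleR_nonneg_nonneg sum_nonneg h_nonneg simp flip: h_def)
  qed
  note h_nonneg = h_nonneg[OF f_nonneg]
  define S where "S n = 2 ^ n *\<^sub>R (\<Sum>i<n. h i)" for n
  have S_nonneg: "0 \<le> S n" for n
    unfolding S_def by (intro scaleR_nonneg_nonneg sum_nonneg h_nonneg) simp
  have fS: "f n = F (S n)" for n unfolding S_def h_def by (rule f)
  have f_norm: "norm (f n) \<le> 1" for n
    using F(2)[OF S_nonneg] by (simp add: fS)
  have big: "d < norm (pprt (h n - S n))" for n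
    using F(3)[OF S_nonneg, of n] by (simp add: h_def flip: fS)
  \<comment> \<open>the supremum in the Riesz-Kantorovich formula for the positive part is nearly attained\<close>
  have "\<exists>a\<ge>0. norm a \<le> 1 \<and> d < (h n - S n) a" for n
  proof -
    obtain x where x: "0 \<le> x" "norm x \<le> 1" "d < pprt (h n - S n) x"
      using positive_functional_norm_witness[of "pprt (h n - S n)" d] big d by auto
    have "\<exists>a\<ge>0. a \<le> x \<and> d < (h n - S n) a"
    proof (rule ccontr)
      assume "\<not> ?thesis"
      then have "rk_sup (h n - S n) x \<le> d"
        using x(1) by (intro rk_sup_least) (auto simp: not_less)
      then show False using x by (simp add: pprt_blinfun rk_pos_part_pos)
    qed
    then show ?thesis using x(2) norm_mono_pos order_trans by blast
  qed
  then obtain a where a: "\<And>n. 0 \<le> a n" "\<And>n. norm (a n) \<le> 1" "\<And>n. d < (h n - S n) (a n)"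
    by metis
  obtain u where u: "0 \<le> u" "\<And>x. 0 \<le> x \<Longrightarrow> norm x \<le> 1 \<Longrightarrow> norm (T (pprt (x - u))) \<le> d / 2"
    using trunc[of "d / 2"] d by auto
  define b where "b n = T (inf (a n) u)" for n
  have inf_nonneg: "0 \<le> inf (a n) u" for n using a u by simp
  have "(\<lambda>n. f n (b n)) \<longlonglongrightarrow> 0"
  proof (rule almost_biorthogonal_null[OF oc])
    show "0 \<le> b n" for n
      unfolding b_def using T inf_nonneg by (simp add: positive_operator_def)
    show "b n \<le> T u" for n
      unfolding b_def by (rule positive_operator_mono[OF T]) simp
    show "0 \<le> f n" for n by (rule f_nonneg)
    show "norm (f n) \<le> 1" for n by (rule f_norm)
    show "f i (b n) \<le> onorm T * (1/2) ^ n" if "i < n" for i n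
    proof -
      have "f i (b n) = h i (inf (a n) u)" by (simp add: b_def h_apply)
      also have "\<dots> \<le> h i (a n)" by (intro blinfun_mono h_nonneg) simp
      also have "\<dots> \<le> (\<Sum>i<n. h i (a n))"
        using that a by (intro member_le_sum) (auto intro: blinfun_nonneg h_nonneg)
      also have "\<dots> = (1/2) ^ n * S n (a n)"
        by (simp add: S_def blinfun.scaleR_left blinfun.sum_left power_divide)
      also have "\<dots> \<le> (1/2) ^ n * h n (a n)"
        using a(3)[of n] d by (intro mult_left_mono) (auto simp: blinfun.diff_left)
      also have "\<dots> \<le> (1/2) ^ n * onorm T"
      proof (intro mult_left_mono)
        have "h n (a n) \<le> norm (f n) * norm (T (a n))"
          using abs_blinfun_apply_le[of "f n" "T (a n)"] by (simp add: h_apply)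
        also have "\<dots> \<le> 1 * (onorm T * norm (a n))"
          by (intro mult_mono f_norm onorm[OF bl]) auto
        also have "\<dots> \<le> onorm T"
          using a(2)[of n] onorm_pos_le[OF bl] by (simp add: mult_left_le)
        finally show "h n (a n) \<le> onorm T" .
      qed simp
      finally show ?thesis by (simp add: mult.commute)
    qed
  qed
  moreover have "d / 2 \<le> f n (b n)" for n
  proof -
    have "0 \<le> S n (a n)" by (intro blinfun_nonneg S_nonneg a)
    then have "d < h n (a n)"
      using a(3)[of n] by (simp add: blinfun.diff_left)
    also have "a n = inf (a n) u + pprt (a n - u)"
      by (rule inf_plus_pprt_diff)
    also have "h n (inf (a n) u + pprt (a n - u)) = f n (b n) + f n (T (pprt (a n - u)))"
      by (simp add: b_def blinfun.add_right h_apply)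
    also have "f n (T (pprt (a n - u))) \<le> norm (f n) * norm (T (pprt (a n - u)))"
      using abs_blinfun_apply_le[of "f n" "T (pprt (a n - u))"] by simp
    also have "\<dots> \<le> 1 * (d / 2)"
      by (intro mult_mono f_norm u a) auto
    finally show ?thesis by simp
  qed
  ultimately have "d / 2 \<le> 0"
    using LIMSEQ_le_const by blast
  then show False using d by simp
qed

section \<open>The second adjoint\<close>

text \<open>
  On the unit ball, \<open>\<bar>\<phi> (T\<^sup>*f)\<bar> \<le> \<bar>\<phi>\<bar> (T\<^sup>*\<bar>f\<bar>)\<close> by positivity of \<open>T\<close>, and \<open>T\<^sup>*\<bar>f\<bar>\<close> is at most \<open>g\<close>
  plus an element of norm at most \<open>d\<close>.
\<close>

lemma norm_biadjoint_le:
  fixes T :: "'a::banach_lattice \<Rightarrow> 'b::banach_lattice"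
    and \<phi> :: "('a \<Rightarrow>\<^sub>L real) \<Rightarrow>\<^sub>L real"
  assumes T: "positive_operator T"
    and g: "\<And>f. 0 \<le> f \<Longrightarrow> norm f \<le> 1 \<Longrightarrow> norm (pprt (banach_adjoint T f - g)) \<le> d"
  shows "norm (banach_adjoint (banach_adjoint T) \<phi>) \<le> \<bar>\<phi>\<bar> g + norm \<phi> * d"
proof -
  note bl = banach_adjoint_bounded_linear[OF positive_operator_bounded_linear[OF T]]
  note neg = linear_neg[OF bounded_linear.linear[OF bl]]
    and scale = linear_scale[OF bounded_linear.linear[OF bl]]
  let ?S = "banach_adjoint T"
  have unit: "\<bar>\<phi>\<bar> (?S \<bar>f\<bar>) \<le> \<bar>\<phi>\<bar> g + norm \<phi> * d" if "norm f \<le> 1" for f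
  proof -
    have "?S \<bar>f\<bar> \<le> g + pprt (?S \<bar>f\<bar> - g)"
    proof -
      have "?S \<bar>f\<bar> - g \<le> pprt (?S \<bar>f\<bar> - g)" by (simp add: pprt_def)
      then show ?thesis by (simp add: diff_le_eq add.commute)
    qed
    then have "\<bar>\<phi>\<bar> (?S \<bar>f\<bar>) \<le> \<bar>\<phi>\<bar> g + \<bar>\<phi>\<bar> (pprt (?S \<bar>f\<bar> - g))"
      unfolding blinfun.add_right[symmetric] by (intro blinfun_mono) simp_all
    also have "\<bar>\<phi>\<bar> (pprt (?S \<bar>f\<bar> - g)) \<le> norm \<bar>\<phi>\<bar> * norm (pprt (?S \<bar>f\<bar> - g))"
      using abs_blinfun_apply_le[of "\<bar>\<phi>\<bar>"] abs_le_D1 by blast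
    also have "\<dots> \<le> norm \<phi> * d"
      using that by (simp only: norm_abs_eq) (intro mult_left_mono g, simp_all)
    finally show ?thesis by simp
  qed
  have pos: "\<phi> (?S f) \<le> \<bar>\<phi>\<bar> (?S \<bar>f\<bar>)" for f
  proof -
    have "?S f \<le> ?S \<bar>f\<bar>" "?S (- f) \<le> ?S \<bar>f\<bar>"
      by (intro banach_adjoint_mono[OF T] abs_ge_self abs_ge_minus_self)+
    then have "\<bar>?S f\<bar> \<le> ?S \<bar>f\<bar>"
      using neg by (simp add: abs_le_iff)
    then show ?thesis
      using blinfun_le_abs[of \<phi> "?S f"] blinfun_mono[of "\<bar>\<phi>\<bar>" "\<bar>?S f\<bar>" "?S \<bar>f\<bar>"] by simp
  qed
  show ?thesis
  proof (rule norm_blinfun_bound)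
    have "\<bar>\<phi>\<bar> (?S \<bar>0\<bar>) \<le> \<bar>\<phi>\<bar> g + norm \<phi> * d" by (rule unit) simp
    then show *: "0 \<le> \<bar>\<phi>\<bar> g + norm \<phi> * d"
      by (simp add: linear_0 bounded_linear.linear[OF bl] blinfun.zero_right)
    fix f
    show "norm (banach_adjoint ?S \<phi> f) \<le> (\<bar>\<phi>\<bar> g + norm \<phi> * d) * norm f"
    proof (cases "f = 0")
      case False
      define k where "k = (1 / norm f) *\<^sub>R f"
      have "norm k \<le> 1" "norm (- k) \<le> 1" using False by (simp_all add: k_def)
      then have "\<bar>\<phi> (?S k)\<bar> \<le> \<bar>\<phi>\<bar> g + norm \<phi> * d"
        using pos[of k] pos[of "- k"] unit[of k]
        by (simp add: neg blinfun.minus_right abs_le_iff)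
      then show ?thesis
        using False by (simp add: k_def banach_adjoint_apply[OF bl]
          scale blinfun.scaleR_right field_simps)
    qed (simp add: blinfun.zero_right)
  qed
qed

lemma modulus_weak_star_null_imp_norm_null:
  fixes T :: "'a::banach_lattice \<Rightarrow> 'b::banach_lattice"
    and \<phi> :: "nat \<Rightarrow> ('a \<Rightarrow>\<^sub>L real) \<Rightarrow>\<^sub>L real"
  assumes T: "positive_operator T"
    and L: "\<And>d. 0 < d \<Longrightarrow> \<exists>g\<ge>0. \<forall>f\<ge>0. norm f \<le> 1 \<longrightarrow> norm (pprt (banach_adjoint T f - g)) \<le> d"
    and null: "\<And>g. 0 \<le> g \<Longrightarrow> (\<lambda>n. \<bar>\<phi> n\<bar> g) \<longlonglongrightarrow> 0"
    and bdd: "\<And>n. norm (\<phi> n) \<le> C"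
  shows "norm_null (\<lambda>n. banach_adjoint (banach_adjoint T) (\<phi> n))"
  unfolding norm_null_def
proof (rule tendstoI)
  fix e :: real assume e: "0 < e"
  have C: "0 \<le> C" using bdd[of 0] norm_ge_zero order_trans by blast
  define d where "d = e / (2 * (C + 1))"
  have d: "0 < d" "C * d < e / 2"
    using C e by (simp_all add: d_def field_simps)
  obtain g where g: "0 \<le> g"
    "\<And>f. 0 \<le> f \<Longrightarrow> norm f \<le> 1 \<Longrightarrow> norm (pprt (banach_adjoint T f - g)) \<le> d"
    using L[OF d(1)] by blast
  have "\<forall>\<^sub>F n in sequentially. \<bar>\<phi> n\<bar> g < e / 2"
    using null[OF g(1)] e by (intro order_tendstoD) auto
  then show "\<forall>\<^sub>F n in sequentially. dist (banach_adjoint (banach_adjoint T) (\<phi> n)) 0 < e"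
  proof (rule eventually_mono)
    fix n assume n: "\<bar>\<phi> n\<bar> g < e / 2"
    have "norm (banach_adjoint (banach_adjoint T) (\<phi> n)) \<le> \<bar>\<phi> n\<bar> g + norm (\<phi> n) * d"
      by (rule norm_biadjoint_le[OF T g(2)])
    also have "norm (\<phi> n) * d \<le> C * d"
      using bdd d by (intro mult_right_mono) auto
    finally show "dist (banach_adjoint (banach_adjoint T) (\<phi> n)) 0 < e"
      using n d by simp
  qed
qed

theorem theorem3p11:
  fixes T :: "'a::banach_lattice \<Rightarrow> 'b::banach_lattice"
  assumes "order_continuous_norm TYPE('a \<Rightarrow>\<^sub>L real)"
    and "order_continuous_norm TYPE('b)"
    and "positive_operator T"
    and "almost_Dunford_Pettis T"
  shows "positively_limited (banach_adjoint T) \<and>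
    almost_limited (banach_adjoint T) \<and>
    almost_Dunford_Pettis (banach_adjoint (banach_adjoint T))"
proof -
  note oc = assms(1,2) and T = assms(3) and DP = assms(4)
  have bl: "bounded_linear (banach_adjoint T)"
    by (intro banach_adjoint_bounded_linear positive_operator_bounded_linear T)
  have trunc: "\<exists>u\<ge>0. \<forall>x\<ge>0. norm x \<le> 1 \<longrightarrow> norm (T (pprt (x - u))) \<le> e" if "0 < e" for e
    by (rule M_weakly_compact_truncation[OF T _ that])
      (rule almost_Dunford_Pettis_disjoint_null[OF oc(1) DP])
  have L: "\<exists>g\<ge>0. \<forall>f\<ge>0. norm f \<le> 1 \<longrightarrow> norm (pprt (banach_adjoint T f - g)) \<le> d"
    if "0 < d" for d
    by (rule positive_adjoint_L_weakly_compact[OF oc(2) T trunc that])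
  have pos: "positively_limited (banach_adjoint T)"
    unfolding positively_limited_def
  proof (intro conjI allI impI bl)
    fix \<phi> :: "nat \<Rightarrow> ('a \<Rightarrow>\<^sub>L real) \<Rightarrow>\<^sub>L real"
    assume \<phi>: "\<forall>n. 0 \<le> \<phi> n" "weak_star_null \<phi>"
    obtain C where "\<And>n. norm (\<phi> n) \<le> C" using weak_star_null_bounded[OF \<phi>(2)] by blast
    then show "norm_null (\<lambda>n. banach_adjoint (banach_adjoint T) (\<phi> n))"
      using \<phi> by (intro modulus_weak_star_null_imp_norm_null[OF T L])
        (auto simp: weak_star_null_def)
  qed
  have lim: "almost_limited (banach_adjoint T)"
    unfolding almost_limited_def
  proof (intro conjI allI impI bl)
    fix \<phi> :: "nat \<Rightarrow> ('a \<Rightarrow>\<^sub>L real) \<Rightarrow>\<^sub>L real"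
    assume \<phi>: "disjoint_seq \<phi>" "weak_star_null \<phi>"
    obtain C where C: "\<And>n. norm (\<phi> n) \<le> C" using weak_star_null_bounded[OF \<phi>(2)] by blast
    show "norm_null (\<lambda>n. banach_adjoint (banach_adjoint T) (\<phi> n))"
      by (rule modulus_weak_star_null_imp_norm_null[OF T _ _ C])
        (erule L, rule bounded_disjoint_functionals_null[OF oc(1) \<phi>(1) C])
  qed
  have "almost_Dunford_Pettis (banach_adjoint (banach_adjoint T))"
    unfolding almost_Dunford_Pettis_def
  proof (intro conjI allI impI)
    show "linear (banach_adjoint (banach_adjoint T))"
      by (intro bounded_linear.linear banach_adjoint_bounded_linear bl)
    fix \<phi> :: "nat \<Rightarrow> ('a \<Rightarrow>\<^sub>L real) \<Rightarrow>\<^sub>L real"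
    assume "disjoint_seq \<phi>" "weakly_null \<phi>"
    then show "norm_null (\<lambda>n. banach_adjoint (banach_adjoint T) (\<phi> n))"
      using lim weakly_null_imp_weak_star_null unfolding almost_limited_def by blast
  qed
  with pos lim show ?thesis by blast
qed

end
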